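(* Let $K$ be a field, $G$ a finite group with a chain of normal subgroups $1=G_0\triangleleft G_1\triangleleft\cdots\triangleleft G_d=G$, $H\triangleleft G$ a normal subgroup and $H_i=H\cap G_i$. Assume that all $H_i$ are normal in $G$, and that an ascending transversal has been fixed for which the associated 2-cocycle $h:G/H\times G/H\to H$ is filtered. If $N$ is an $FKH$-fragment (respectively a glider representation, respectively a natural fragment), then $M=N^G=K[G/H]\otimes_KN$ is an $FKG$-fragment (respectively a glider representation, respectively a natural fragment).
   Context: **Filtrations.** $FKG$ is given by $F_nKG = KG_n$ for $0\le n\le d$ and $F_nKG=KG$ for $n\geq d$; $FKH$ by $F_nKH = KH_n$ for $0\le n\le d$ and $F_nKH=KH$ for $n\ge d$. **Fragments.** Let $FR$ be a positive filtration $F_0R\subset F_1R\subset\cdots$ on a ring $R$, with subring $S=F_0R\ni 1$. A (left) $FR$-fragment $M$ is an $S$-module with a descending chain of subgroups $M=M_0\supseteq M_1\supseteq\cdots$ such that: (f1) for every $i$ there is an $S$-module $M_i^*$ with $M\supseteq M_i^*\supseteq M_i$ and an operation $\varphi_i:F_iR\times M_i^*\to M$, $(\lambda,m)\mapsto\lambda m$, additive in each variable, with $1m=m$; (f2) for $j\le i$, $F_jR\cdot M_i\subset M_{i-j}$, and for $\lambda\in F_jR$, $m\in M_i$ the elements $\lambda m$ computed by $\varphi_i$ and by $\varphi_j$ coincide; (f3) whenever $F_iR\,F_jR\subset F_\mu R$ (with $j\le\mu$), $F_jR\,M_\mu\subset M_i^*\cap M_{\mu-j}$, and $\lambda(\delta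 m)=(\lambda\delta)m$ for $\lambda\in F_iR,\delta\in F_jR,m\in M_\mu$. $M$ is a glider representation if the actions are induced from an $R$-module $\Omega\supseteq M$; in that case $M_i^*=\{m\in M: F_iR\,m\subset M\}$. If moreover $M_i^*=M_i$ for all $i$, $M$ is called natural. **Transversal and cocycle.** $G_i/H_i\cong G_iH/H$ is regarded as a subgroup of $G/H$. An ascending transversal is a chain $1\in T_1\subseteq T_2\subseteq\cdots\subseteq T_d=T$ with $T_i\subset G_i$ a set of representatives of the cosets $gH_i$ in $G_i$. Let $\sigma:G/H\to T$ be the corresponding section (so every $g\in G$ is $\sigma(\bar g)h$ for a unique $h\in H$), and define $h(-,-):G/H\times G/H\to H$ by $\sigma(\bar g_1)\sigma(\bar g_2)=\sigma(\overline{g_1g_2})\,h(\bar g_1,\bar g_2)$. The cocycle is filtered if $h(\bar a,\bar g)\in H_i$ for every $i$, every $\bar a\in G_i/H_i$ and every $g\in G$. **Induced fragment.** $N^G=M=\bigoplus_{\bar g\in G/H}K\bar g\otimes N$, with chain $M_j=K[G/H]\otimes_KN_j$. For $g_1=t_1h_1\in G_j$ with $t_1=\sigma(\bar g_1)$, $h_1\in H_j$, and $t=\sigma(\bar g)$, $n\in N_j$, the action is $g_1\cdot(\bar g\otimes n)=\overline{g_1g}\otimes h(\bar g_1,\bar g)\,t^{-1}h_1t\,n$, extended $K$-bilinearly. If $N$ is a glider representation inside a $KH$-module $\Omega$, then $K[G/H]\otimes_K\Omega$ carries the $KG$-module structure given by the same formula. *)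

theory Defs
  imports "HOL-Algebra.Coset" "HOL-Algebra.Module"
begin

section \<open>Filtered rings and fragments\<close>

locale positive_filtration = ring R
  for R :: "('r, 'c) ring_scheme" (structure) and F :: "nat \<Rightarrow> 'r set" +
  assumes filt_subgroup: "subgroup (F i) (add_monoid R)"
    and filt_mono: "F i \<subseteq> F (Suc i)"
    and filt_mult: "\<lbrakk>a \<in> F i; b \<in> F j\<rbrakk> \<Longrightarrow> a \<otimes> b \<in> F (i + j)"
    and filt_one: "\<one> \<in> F 0"

text \<open>
  The library locale \<^locale>\<open>module\<close> requires a commutative ring of scalars, so it does not
  cover modules over group algebras.
\<close>

locale left_module = R?: ring R + M?: abelian_group M
  for R :: "('r, 'c) ring_scheme" (structure)
    and M :: "('r, 'm, 'z) module_scheme" (structure) +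
  assumes lm_closed: "\<lbrakk>a \<in> carrier R; x \<in> carrier M\<rbrakk> \<Longrightarrow> a \<odot>\<^bsub>M\<^esub> x \<in> carrier M"
    and lm_l_distr: "\<lbrakk>a \<in> carrier R; b \<in> carrier R; x \<in> carrier M\<rbrakk> \<Longrightarrow>
          (a \<oplus>\<^bsub>R\<^esub> b) \<odot>\<^bsub>M\<^esub> x = a \<odot>\<^bsub>M\<^esub> x \<oplus>\<^bsub>M\<^esub> b \<odot>\<^bsub>M\<^esub> x"
    and lm_r_distr: "\<lbrakk>a \<in> carrier R; x \<in> carrier M; y \<in> carrier M\<rbrakk> \<Longrightarrow>
          a \<odot>\<^bsub>M\<^esub> (x \<oplus>\<^bsub>M\<^esub> y) = a \<odot>\<^bsub>M\<^esub> x \<oplus>\<^bsub>M\<^esub> a \<odot>\<^bsub>M\<^esub> y"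
    and lm_assoc: "\<lbrakk>a \<in> carrier R; b \<in> carrier R; x \<in> carrier M\<rbrakk> \<Longrightarrow>
          (a \<otimes>\<^bsub>R\<^esub> b) \<odot>\<^bsub>M\<^esub> x = a \<odot>\<^bsub>M\<^esub> (b \<odot>\<^bsub>M\<^esub> x)"
    and lm_one: "x \<in> carrier M \<Longrightarrow> \<one>\<^bsub>R\<^esub> \<odot>\<^bsub>M\<^esub> x = x"

text \<open>
  \<open>level M i\<close>, \<open>star M i\<close> and \<open>act M i\<close> are $M_i$, $M_i^*$ and $\varphi_i$.
  The operation \<open>act M i\<close> is only meaningful on \<open>F i \<times> star M i\<close>.
\<close>

record ('r, 'm) fragment = "('r, 'm) module" +
  level :: "nat \<Rightarrow> 'm set"
  star :: "nat \<Rightarrow> 'm set"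
  act :: "nat \<Rightarrow> 'r \<Rightarrow> 'm \<Rightarrow> 'm"

text \<open>
  The last equation of (f1) says that $\varphi_0$, which is defined on all of
  $M = M_0 = M_0^*$, is the given action of $S = F_0R$. In (f3) the element $\delta m$ may be
  computed by $\varphi_j$ or by $\varphi_\mu$, which agree by (f2).
\<close>

locale fragment =
  positive_filtration R F + S: left_module "R\<lparr>carrier := F 0\<rparr>" M
  for R :: "('r, 'c) ring_scheme" (structure) and F :: "nat \<Rightarrow> 'r set"
    and M :: "('r, 'm) fragment" +
  assumes level_0: "level M 0 = carrier M"
    and level_subgroup: "subgroup (level M i) (add_monoid M)"
    and level_antimono: "level M (Suc i) \<subseteq> level M i"
    and f1_submodule: "submodule (star M i) (R\<lparr>carrier := F 0\<rparr>) M"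
    and f1_level: "level M i \<subseteq> star M i"
    and f1_closed: "\<lbrakk>a \<in> F i; x \<in> star M i\<rbrakk> \<Longrightarrow> act M i a x \<in> carrier M"
    and f1_add_left: "\<lbrakk>a \<in> F i; b \<in> F i; x \<in> star M i\<rbrakk> \<Longrightarrow>
          act M i (a \<oplus> b) x = act M i a x \<oplus>\<^bsub>M\<^esub> act M i b x"
    and f1_add_right: "\<lbrakk>a \<in> F i; x \<in> star M i; y \<in> star M i\<rbrakk> \<Longrightarrow>
          act M i a (x \<oplus>\<^bsub>M\<^esub> y) = act M i a x \<oplus>\<^bsub>M\<^esub> act M i a y"
    and f1_one: "x \<in> star M i \<Longrightarrow> act M i \<one> x = x"
    and f1_scalar: "\<lbrakk>a \<in> F 0; x \<in> carrier M\<rbrakk> \<Longrightarrow> act M 0 a x = a \<odot>\<^bsub>M\<^esub> x"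
    and f2_level: "\<lbrakk>j \<le> i; a \<in> F j; x \<in> level M i\<rbrakk> \<Longrightarrow> act M j a x \<in> level M (i - j)"
    and f2_coincide: "\<lbrakk>j \<le> i; a \<in> F j; x \<in> level M i\<rbrakk> \<Longrightarrow> act M i a x = act M j a x"
    and f3_level: "\<lbrakk>\<And>a b. \<lbrakk>a \<in> F i; b \<in> F j\<rbrakk> \<Longrightarrow> a \<otimes> b \<in> F \<mu>; j \<le> \<mu>;
          b \<in> F j; x \<in> level M \<mu>\<rbrakk> \<Longrightarrow> act M j b x \<in> star M i \<inter> level M (\<mu> - j)"
    and f3_assoc: "\<lbrakk>\<And>a b. \<lbrakk>a \<in> F i; b \<in> F j\<rbrakk> \<Longrightarrow> a \<otimes> b \<in> F \<mu>; j \<le> \<mu>;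
          a \<in> F i; b \<in> F j; x \<in> level M \<mu>\<rbrakk> \<Longrightarrow>
          act M i a (act M j b x) = act M \<mu> (a \<otimes> b) x"

text \<open>
  Since $M \subseteq \Omega$, the module $\Omega$ lives over the same type as $M$.
\<close>

definition glider_representation ::
  "('r, 'c) ring_scheme \<Rightarrow> (nat \<Rightarrow> 'r set) \<Rightarrow> ('r, 'm) fragment \<Rightarrow> bool"
  where "glider_representation R F M \<longleftrightarrow>
    fragment R F M \<and>
    (\<exists>\<Omega> :: ('r, 'm) module.
       left_module R \<Omega> \<and> carrier M \<subseteq> carrier \<Omega> \<and>
       (\<forall>x \<in> carrier M. \<forall>y \<in> carrier M. x \<oplus>\<^bsub>M\<^esub> y = x \<oplus>\<^bsub>\<Omega>\<^esub> y) \<and>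
       (\<forall>i. \<forall>a \<in> F i. \<forall>x \<in> star M i. act M i a x = a \<odot>\<^bsub>\<Omega>\<^esub> x) \<and>
       (\<forall>i. star M i = {x \<in> carrier M. \<forall>a \<in> F i. a \<odot>\<^bsub>\<Omega>\<^esub> x \<in> carrier M}))"

definition natural_fragment ::
  "('r, 'c) ring_scheme \<Rightarrow> (nat \<Rightarrow> 'r set) \<Rightarrow> ('r, 'm) fragment \<Rightarrow> bool"
  where "natural_fragment R F M \<longleftrightarrow>
    glider_representation R F M \<and> (\<forall>i. star M i = level M i)"


section \<open>Group algebras of finite groups\<close>

definition group_algebra ::
  "('k, 'c) ring_scheme \<Rightarrow> ('a, 'b) monoid_scheme \<Rightarrow> ('a \<Rightarrow> 'k) ring"
  where "group_algebra K G = \<lparr>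
    carrier = carrier G \<rightarrow>\<^sub>E carrier K,
    mult = (\<lambda>a b. \<lambda>g\<in>carrier G. \<Oplus>\<^bsub>K\<^esub>x\<in>carrier G. a x \<otimes>\<^bsub>K\<^esub> b (inv\<^bsub>G\<^esub> x \<otimes>\<^bsub>G\<^esub> g)),
    one = (\<lambda>g\<in>carrier G. if g = \<one>\<^bsub>G\<^esub> then \<one>\<^bsub>K\<^esub> else \<zero>\<^bsub>K\<^esub>),
    zero = (\<lambda>g\<in>carrier G. \<zero>\<^bsub>K\<^esub>),
    add = (\<lambda>a b. \<lambda>g\<in>carrier G. a g \<oplus>\<^bsub>K\<^esub> b g)\<rparr>"

text \<open>The element $c \cdot g$ of $KG$.\<close>

definition ga_monom ::
  "('k, 'c) ring_scheme \<Rightarrow> ('a, 'b) monoid_scheme \<Rightarrow> 'k \<Rightarrow> 'a \<Rightarrow> 'a \<Rightarrow> 'k"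
  where "ga_monom K G c g = (\<lambda>x\<in>carrier G. if x = g then c else \<zero>\<^bsub>K\<^esub>)"

definition ga_filtration ::
  "('k, 'c) ring_scheme \<Rightarrow> ('a, 'b) monoid_scheme \<Rightarrow> (nat \<Rightarrow> 'a set) \<Rightarrow> nat \<Rightarrow> nat \<Rightarrow> ('a \<Rightarrow> 'k) set"
  where "ga_filtration K G Gs d n =
    (if n \<le> d
     then {a \<in> carrier (group_algebra K G). \<forall>g \<in> carrier G - Gs n. a g = \<zero>\<^bsub>K\<^esub>}
     else carrier (group_algebra K G))"


section \<open>Chains of subgroups, transversals and cocycles\<close>

text \<open>
  Each $G_i$ is only required to be normal in $G_{i+1}$, as in $G_i \triangleleft G_{i+1}$, and not
  in $G$; that the $H \cap G_i$ are normal in $G$ is thus a genuine extra hypothesis.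
\<close>

definition normal_chain :: "('a, 'b) monoid_scheme \<Rightarrow> (nat \<Rightarrow> 'a set) \<Rightarrow> nat \<Rightarrow> bool"
  where "normal_chain G Gs d \<longleftrightarrow>
    Gs 0 = {\<one>\<^bsub>G\<^esub>} \<and> Gs d = carrier G \<and>
    (\<forall>i<d. Gs i \<lhd> (G\<lparr>carrier := Gs (Suc i)\<rparr>))"

definition ascending_transversal ::
  "('a, 'b) monoid_scheme \<Rightarrow> 'a set \<Rightarrow> (nat \<Rightarrow> 'a set) \<Rightarrow> nat \<Rightarrow> (nat \<Rightarrow> 'a set) \<Rightarrow> bool"
  where "ascending_transversal G H Gs d T \<longleftrightarrow>
    \<one>\<^bsub>G\<^esub> \<in> T 1 \<and>
    (\<forall>i. 1 \<le> i \<and> i < d \<longrightarrow> T i \<subseteq> T (Suc i)) \<and>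
    (\<forall>i. 1 \<le> i \<and> i \<le> d \<longrightarrow>
       T i \<subseteq> Gs i \<and> (\<forall>g \<in> Gs i. \<exists>!t. t \<in> T i \<and> g \<in> t <#\<^bsub>G\<^esub> (H \<inter> Gs i)))"

text \<open>
  Elements of $G/H$ are cosets, as in \<open>G Mod H\<close>; since $H$ is normal,
  \<open>H #>\<^bsub>G\<^esub> g\<close> is the coset $\overline{g} = gH$. The parameter \<open>T\<close> of the following two
  definitions is the full transversal $T = T_d$.
\<close>

definition section_of :: "'a set \<Rightarrow> 'a set \<Rightarrow> 'a"
  where "section_of T X = (THE t. t \<in> T \<and> t \<in> X)"

definition cocycle :: "('a, 'b) monoid_scheme \<Rightarrow> 'a set \<Rightarrow> 'a set \<Rightarrow> 'a set \<Rightarrow> 'a"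
  where "cocycle G T X Y =
    inv\<^bsub>G\<^esub> (section_of T (X <#>\<^bsub>G\<^esub> Y)) \<otimes>\<^bsub>G\<^esub> (section_of T X \<otimes>\<^bsub>G\<^esub> section_of T Y)"

text \<open>Under $G_i/H_i \cong G_iH/H$, the elements of $G_i/H_i$ are the cosets $\overline{a}$ with $a \in G_i$.\<close>

definition filtered_cocycle ::
  "('a, 'b) monoid_scheme \<Rightarrow> 'a set \<Rightarrow> (nat \<Rightarrow> 'a set) \<Rightarrow> nat \<Rightarrow> (nat \<Rightarrow> 'a set) \<Rightarrow> bool"
  where "filtered_cocycle G H Gs d T \<longleftrightarrow>
    (\<forall>i\<le>d. \<forall>a \<in> Gs i. \<forall>g \<in> carrier G.
       cocycle G (T d) (H #>\<^bsub>G\<^esub> a) (H #>\<^bsub>G\<^esub> g) \<in> H \<inter> Gs i)"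


section \<open>The induced fragment\<close>

text \<open>
  As $K[G/H]$ has the $K$-basis $G/H$, an element
  $\sum_{X \in G/H} X \otimes n_X$ of $K[G/H] \otimes_K N = \bigoplus_{X \in G/H} KX \otimes N$ is
  represented by the function $X \mapsto n_X$ on \<open>carrier (G Mod H)\<close>. With this,
  $K[G/H] \otimes_K N_j$ consists of the functions with values in $N_j$.
  The scalar action below is that of $F_0KG = K \cdot 1$; the field $K$ acts on \<open>N\<close> through
  $F_0KH = K \cdot 1$.
\<close>

definition induced_module ::
  "('k, 'c) ring_scheme \<Rightarrow> ('a, 'b) monoid_scheme \<Rightarrow> 'a set \<Rightarrow> ('a \<Rightarrow> 'k, 'm, 'z) module_scheme
    \<Rightarrow> ('a \<Rightarrow> 'k, 'a set \<Rightarrow> 'm) module"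
  where "induced_module K G H N = \<lparr>
    carrier = carrier (G Mod H) \<rightarrow>\<^sub>E carrier N,
    mult = undefined,
    one = undefined,
    zero = (\<lambda>X\<in>carrier (G Mod H). \<zero>\<^bsub>N\<^esub>),
    add = (\<lambda>u v. \<lambda>X\<in>carrier (G Mod H). u X \<oplus>\<^bsub>N\<^esub> v X),
    smult = (\<lambda>a u. \<lambda>X\<in>carrier (G Mod H).
       ga_monom K (G\<lparr>carrier := H\<rparr>) (a \<one>\<^bsub>G\<^esub>) \<one>\<^bsub>G\<^esub> \<odot>\<^bsub>N\<^esub> u X)\<rparr>"

definition pure_tensor ::
  "('a, 'b) monoid_scheme \<Rightarrow> 'a set \<Rightarrow> ('r, 'm, 'z) module_scheme \<Rightarrow> 'a set \<Rightarrow> 'm \<Rightarrow> 'a set \<Rightarrow> 'm"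
  where "pure_tensor G H N X n =
    (\<lambda>Y\<in>carrier (G Mod H). if Y = X then n else \<zero>\<^bsub>N\<^esub>)"

text \<open>
  $g_1 \cdot (X \otimes n) = \overline{g_1} X \otimes h(\overline{g_1}, X)\, t^{-1} h_1 t\, n$ with
  $g_1 = t_1 h_1$, $t_1 = \sigma(\overline{g_1})$, $t = \sigma(X)$, where the element of $H_j$ acts
  on $n$ by $\varphi_j$.
\<close>

definition induced_basic_act ::
  "('k, 'c) ring_scheme \<Rightarrow> ('a, 'b) monoid_scheme \<Rightarrow> 'a set \<Rightarrow> 'a set
    \<Rightarrow> ('a \<Rightarrow> 'k, 'm) fragment \<Rightarrow> nat \<Rightarrow> 'a \<Rightarrow> 'a set \<Rightarrow> 'm \<Rightarrow> 'a set \<Rightarrow> 'm"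
  where "induced_basic_act K G H T N j g\<^sub>1 X n =
    (let t\<^sub>1 = section_of T (H #>\<^bsub>G\<^esub> g\<^sub>1);
         h\<^sub>1 = inv\<^bsub>G\<^esub> t\<^sub>1 \<otimes>\<^bsub>G\<^esub> g\<^sub>1;
         t = section_of T X;
         k = cocycle G T (H #>\<^bsub>G\<^esub> g\<^sub>1) X \<otimes>\<^bsub>G\<^esub> (inv\<^bsub>G\<^esub> t \<otimes>\<^bsub>G\<^esub> h\<^sub>1 \<otimes>\<^bsub>G\<^esub> t)
     in pure_tensor G H N ((H #>\<^bsub>G\<^esub> g\<^sub>1) <#>\<^bsub>G\<^esub> X)
          (act N j (ga_monom K (G\<lparr>carrier := H\<rparr>) \<one>\<^bsub>K\<^esub> k) n))"

text \<open>
  For $j \ge d$ one has $F_jKG = KG = KG_d$, whence the \<open>min j d\<close>.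
\<close>

definition induced_act ::
  "('k, 'c) ring_scheme \<Rightarrow> ('a, 'b) monoid_scheme \<Rightarrow> 'a set \<Rightarrow> (nat \<Rightarrow> 'a set) \<Rightarrow> nat
    \<Rightarrow> (nat \<Rightarrow> 'a set) \<Rightarrow> ('a \<Rightarrow> 'k, 'm) fragment
    \<Rightarrow> nat \<Rightarrow> ('a \<Rightarrow> 'k) \<Rightarrow> ('a set \<Rightarrow> 'm) \<Rightarrow> 'a set \<Rightarrow> 'm"
  where "induced_act K G H Gs d T N j a u =
    (\<Oplus>\<^bsub>induced_module K G H N\<^esub>g\<^sub>1\<in>Gs (min j d).
       \<Oplus>\<^bsub>induced_module K G H N\<^esub>X\<in>carrier (G Mod H).
         ga_monom K G (a g\<^sub>1) \<one>\<^bsub>G\<^esub> \<odot>\<^bsub>induced_module K G H N\<^esub>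
           induced_basic_act K G H (T d) N j g\<^sub>1 X (u X))"

text \<open>
  The stars are $M_j^* = K[G/H] \otimes_K N_j^*$, on which $\varphi_j$ is given by the same formula
  as on $M_j$, now with $n \in N_j^*$.
\<close>

definition induced_fragment ::
  "('k, 'c) ring_scheme \<Rightarrow> ('a, 'b) monoid_scheme \<Rightarrow> 'a set \<Rightarrow> (nat \<Rightarrow> 'a set) \<Rightarrow> nat
    \<Rightarrow> (nat \<Rightarrow> 'a set) \<Rightarrow> ('a \<Rightarrow> 'k, 'm) fragment \<Rightarrow> ('a \<Rightarrow> 'k, 'a set \<Rightarrow> 'm) fragment"
  where "induced_fragment K G H Gs d T N =
    module.extend (induced_module K G H N) (fragment.fields
      (\<lambda>j. carrier (G Mod H) \<rightarrow>\<^sub>E level N j)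
      (\<lambda>j. carrier (G Mod H) \<rightarrow>\<^sub>E star N j)
      (induced_act K G H Gs d T N))"

end

theory Submission
  imports Defs "HOL-Algebra.Subrings"
begin

text \<open>
  Writing \<open>g \<sigma>(X) = \<sigma>(gX) \<kappa>(g, X)\<close> with \<open>\<kappa>(g, X) \<in> H\<close>, the action on the induced module is
  \<open>g (X \<otimes> n) = gX \<otimes> \<kappa>(g, X) n\<close>, where \<open>\<kappa>(g g', X) = \<kappa>(g, g'X) \<kappa>(g', X)\<close>. The filtered
  cocycle and the normality of \<open>H\<^sub>i\<close> in \<open>G\<close> give \<open>\<kappa>(g, X) \<in> H\<^sub>i\<close> for \<open>g \<in> G\<^sub>i\<close>, so each axiom for
  the induced fragment reduces coset by coset to the same axiom for \<open>N\<close>. If \<open>N\<close> sits in a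
  \<open>KH\<close>-module \<open>\<Omega>\<close>, the same result applied to \<open>\<Omega>\<close> with the constant chain makes
  \<open>K[G/H] \<otimes> \<Omega>\<close> a \<open>KG\<close>-module. The stars are the right ones because every \<open>h \<in> H\<^sub>i\<close> equals
  \<open>\<kappa>(\<sigma>(X) h \<sigma>(X)\<inverse>, X)\<close>, where the first argument lies in \<open>H\<^sub>i\<close> and fixes \<open>X\<close>.
\<close>

section \<open>Finite sums and modules of functions\<close>

text \<open>The difficulty is partiality. The operation phi_j of \<open>N\<close> is defined only on
  \<open>star N j\<close>, is additive only there, and composes only on \<open>level N \<mu>\<close>
  under the condition of (f3). Every manipulation of the double sum for \<open>a (b u)\<close>
  therefore needs a proof that the vectors involved lie in the right star or level. Two translations
  make this manageable. The condition of (f3) for KG is an inclusion between a product of filtration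
  parts and a third part; tested on group elements it says that G_i and G_j lie in G_\<mu>, and
  intersecting with \<open>H\<close> gives the condition for KH. Moreover, a coefficient is kept
  apart from the group element to which it belongs, as in the definition of the action: it acts
  through F_0, and (f3) merges it with the group element wherever the vector lies deep enough in the
  chain.\<close>

lemma (in abelian_monoid) finsum_swap:
  assumes "finite A" "finite B" and "\<And>a b. \<lbrakk>a \<in> A; b \<in> B\<rbrakk> \<Longrightarrow> f a b \<in> carrier G"
  shows "(\<Oplus>a\<in>A. \<Oplus>b\<in>B. f a b) = (\<Oplus>b\<in>B. \<Oplus>a\<in>A. f a b)"
  using assms(1,3)
proof (induction A rule: finite_induct)
  case empty
  then show ?case by (simp add: finsum_zero)
next
  case (insert x A)
  have "(\<Oplus>a\<in>insert x A. \<Oplus>b\<in>B. f a b) = (\<Oplus>b\<in>B. f x b) \<oplus> (\<Oplus>a\<in>A. \<Oplus>b\<in>B. f a b)"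
    using insert by (intro finsum_insert) (auto intro!: finsum_closed)
  also have "\<dots> = (\<Oplus>b\<in>B. f x b \<oplus> (\<Oplus>a\<in>A. f a b))"
    using insert by (subst finsum_addf) (auto intro!: finsum_closed)
  also have "\<dots> = (\<Oplus>b\<in>B. \<Oplus>a\<in>insert x A. f a b)"
    using insert by (intro finsum_cong') (auto intro!: finsum_closed simp: finsum_insert Pi_iff)
  finally show ?case .
qed

lemma (in abelian_monoid) finsum_cong_closed:
  assumes "\<And>x. x \<in> A \<Longrightarrow> f x = g x" and "\<And>x. x \<in> A \<Longrightarrow> g x \<in> carrier G"
  shows "finsum G f A = finsum G g A"
  using assms by (intro finsum_cong') auto

lemma (in abelian_monoid) finsum_subset_eq:
  assumes "finite B" "A \<subseteq> B" "\<And>x. x \<in> B \<Longrightarrow> f x \<in> carrier G" "\<And>x. x \<in> B - A \<Longrightarrow> f x = \<zero>"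
  shows "finsum G f A = finsum G f B"
  using assms by (intro add.finprod_mono_neutral_cong_left) simp_all

lemma (in abelian_group) finsum_in_subgroup:
  assumes "subgroup L (add_monoid G)" and "\<And>x. x \<in> A \<Longrightarrow> f x \<in> L"
  shows "finsum G f A \<in> L"
proof (cases "finite A")
  case True
  then show ?thesis using assms(2)
  proof (induction A rule: finite_induct)
    case empty
    then show ?case using subgroup.one_closed[OF assms(1)] by simp
  next
    case (insert x A)
    then have "finsum G f (insert x A) = f x \<oplus> finsum G f A"
      using subgroup.mem_carrier[OF assms(1)] by (intro finsum_insert) auto
    then show ?case using insert subgroup.m_closed[OF assms(1)] by auto
  qed
next
  case False
  then show ?thesis using subgroup.one_closed[OF assms(1)] by simp
qed

text \<open>Additivity is asked only on a subgroup \<open>L\<close> because phi_i is additive only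
  on \<open>star N i\<close>. That \<open>\<phi>\<close> sends zero to zero is not assumed; it
  follows from additivity by cancelling in \<open>B\<close>.\<close>

lemma finsum_additive_on:
  assumes "abelian_group A" "abelian_group B" "subgroup L (add_monoid A)"
    and "\<And>x. x \<in> L \<Longrightarrow> \<phi> x \<in> carrier B"
    and "\<And>x y. \<lbrakk>x \<in> L; y \<in> L\<rbrakk> \<Longrightarrow> \<phi> (x \<oplus>\<^bsub>A\<^esub> y) = \<phi> x \<oplus>\<^bsub>B\<^esub> \<phi> y"
    and "finite I" and "\<And>i. i \<in> I \<Longrightarrow> f i \<in> L"
  shows "\<phi> (finsum A f I) = (\<Oplus>\<^bsub>B\<^esub>i\<in>I. \<phi> (f i))"
proof -
  interpret A: abelian_group A by fact
  interpret B: abelian_group B by fact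
  note L = subgroup.one_closed[OF assms(3), simplified] subgroup.mem_carrier[OF assms(3), simplified]
  have "\<phi> \<zero>\<^bsub>A\<^esub> = \<phi> \<zero>\<^bsub>A\<^esub> \<oplus>\<^bsub>B\<^esub> \<phi> \<zero>\<^bsub>A\<^esub>"
    using assms(5)[OF L(1) L(1)] by simp
  then have zero: "\<phi> \<zero>\<^bsub>A\<^esub> = \<zero>\<^bsub>B\<^esub>"
    using assms(4)[OF L(1)] by (metis B.add.r_cancel_one B.r_zero)
  show ?thesis using assms(6,7)
  proof (induction I rule: finite_induct)
    case (insert x I)
    have "finsum A f (insert x I) = f x \<oplus>\<^bsub>A\<^esub> finsum A f I"
      using insert L by (intro A.finsum_insert) auto
    moreover have "finsum A f I \<in> L" using insert by (intro A.finsum_in_subgroup assms(3)) auto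
    moreover have "(\<Oplus>\<^bsub>B\<^esub>i\<in>insert x I. \<phi> (f i)) = \<phi> (f x) \<oplus>\<^bsub>B\<^esub> (\<Oplus>\<^bsub>B\<^esub>i\<in>I. \<phi> (f i))"
      using insert assms(4) by (intro B.finsum_insert) auto
    ultimately show ?case using insert assms(5) by simp
  qed (simp add: zero)
qed

text \<open>Only the additive fields of \<open>P\<close> are prescribed, so that one lemma serves
  the group algebra, the induced module and the induced fragment, which are records of different
  types.\<close>

lemma PiE_abelian_group:
  assumes "abelian_group N" "carrier P = I \<rightarrow>\<^sub>E carrier N"
    and "zero P = (\<lambda>x\<in>I. \<zero>\<^bsub>N\<^esub>)" and "add P = (\<lambda>u v. \<lambda>x\<in>I. u x \<oplus>\<^bsub>N\<^esub> v x)"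
  shows "abelian_group P"
proof (rule abelian_groupI)
  interpret N: abelian_group N by fact
  fix u assume "u \<in> carrier P"
  then show "\<exists>v\<in>carrier P. v \<oplus>\<^bsub>P\<^esub> u = \<zero>\<^bsub>P\<^esub>"
    unfolding assms by (intro bexI[of _ "\<lambda>x\<in>I. \<ominus>\<^bsub>N\<^esub> u x"]) (auto intro!: restrict_ext N.l_neg)
next
  interpret N: abelian_group N by fact
  fix u v w assume "u \<in> carrier P" "v \<in> carrier P" "w \<in> carrier P"
  then show "(u \<oplus>\<^bsub>P\<^esub> v) \<oplus>\<^bsub>P\<^esub> w = u \<oplus>\<^bsub>P\<^esub> (v \<oplus>\<^bsub>P\<^esub> w)"
    unfolding assms by (auto intro!: restrict_ext N.a_assoc)
next
  interpret N: abelian_group N by fact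
  fix u v assume "u \<in> carrier P" "v \<in> carrier P"
  then show "u \<oplus>\<^bsub>P\<^esub> v \<in> carrier P" "u \<oplus>\<^bsub>P\<^esub> v = v \<oplus>\<^bsub>P\<^esub> u"
    unfolding assms by (auto intro!: restrict_ext N.a_comm)
next
  interpret N: abelian_group N by fact
  show "\<zero>\<^bsub>P\<^esub> \<in> carrier P" unfolding assms by auto
  fix u assume "u \<in> carrier P"
  then show "\<zero>\<^bsub>P\<^esub> \<oplus>\<^bsub>P\<^esub> u = u"
    unfolding assms by (intro ext) (auto simp: PiE_arb[of u] intro!: N.l_zero)
qed

lemma PiE_finsum_apply:
  assumes "abelian_group N" "carrier P = I \<rightarrow>\<^sub>E carrier N"
    and "zero P = (\<lambda>x\<in>I. \<zero>\<^bsub>N\<^esub>)" and "add P = (\<lambda>u v. \<lambda>x\<in>I. u x \<oplus>\<^bsub>N\<^esub> v x)"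
    and "finite A" and "\<And>i. i \<in> A \<Longrightarrow> f i \<in> carrier P" and "x \<in> I"
  shows "finsum P f A x = (\<Oplus>\<^bsub>N\<^esub>i\<in>A. f i x)"
proof -
  have P: "abelian_group P" using PiE_abelian_group[OF assms(1-4)] .
  interpret P: abelian_group P by fact
  show ?thesis
    using assms(6,7) by (intro finsum_additive_on[OF P assms(1) P.add.subgroup_self, of "\<lambda>u. u x"])
      (auto simp: assms(2-5))
qed

lemma PiE_subgroup:
  assumes "abelian_group N" "carrier P = I \<rightarrow>\<^sub>E carrier N"
    and "zero P = (\<lambda>x\<in>I. \<zero>\<^bsub>N\<^esub>)" and "add P = (\<lambda>u v. \<lambda>x\<in>I. u x \<oplus>\<^bsub>N\<^esub> v x)"
    and "subgroup L (add_monoid N)"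
  shows "subgroup (I \<rightarrow>\<^sub>E L) (add_monoid P)"
proof -
  interpret N: abelian_group N by fact
  interpret P: abelian_group P using PiE_abelian_group[OF assms(1-4)] .
  note L = subgroup.mem_carrier[OF assms(5), simplified] subgroup.one_closed[OF assms(5), simplified]
    subgroup.m_closed[OF assms(5), simplified] subgroup.m_inv_closed[OF assms(5)]
  show ?thesis
  proof (rule group.subgroupI[OF P.a_group])
    show "I \<rightarrow>\<^sub>E L \<subseteq> carrier (add_monoid P)" using L(1) by (auto simp: assms(2))
    show "I \<rightarrow>\<^sub>E L \<noteq> {}" using L(2) by (auto simp: PiE_eq_empty_iff)
  next
    fix u assume u: "u \<in> I \<rightarrow>\<^sub>E L"
    have u': "u \<in> I \<rightarrow>\<^sub>E carrier N" using u L(1) by blast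
    have "\<ominus>\<^bsub>P\<^esub> u = (\<lambda>x\<in>I. \<ominus>\<^bsub>N\<^esub> u x)"
      using u' by (intro P.minus_equality) (auto simp: assms(2-4) intro!: restrict_ext N.l_neg)
    then show "inv\<^bsub>add_monoid P\<^esub> u \<in> I \<rightarrow>\<^sub>E L" using u L(4) by (auto simp: a_inv_def)
  next
    fix u v assume "u \<in> I \<rightarrow>\<^sub>E L" "v \<in> I \<rightarrow>\<^sub>E L"
    then show "u \<otimes>\<^bsub>add_monoid P\<^esub> v \<in> I \<rightarrow>\<^sub>E L" using L(3) by (auto simp: assms(4))
  qed
qed

section \<open>Group algebras\<close>

lemma group_algebra_simps [simp]:
  "carrier (group_algebra K G) = carrier G \<rightarrow>\<^sub>E carrier K"
  "zero (group_algebra K G) = (\<lambda>g\<in>carrier G. \<zero>\<^bsub>K\<^esub>)"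
  "one (group_algebra K G) = (\<lambda>g\<in>carrier G. if g = \<one>\<^bsub>G\<^esub> then \<one>\<^bsub>K\<^esub> else \<zero>\<^bsub>K\<^esub>)"
  "add (group_algebra K G) = (\<lambda>a b. \<lambda>g\<in>carrier G. a g \<oplus>\<^bsub>K\<^esub> b g)"
  by (simp_all add: group_algebra_def)

lemma group_algebra_mult:
  "a \<otimes>\<^bsub>group_algebra K G\<^esub> b =
    (\<lambda>g\<in>carrier G. \<Oplus>\<^bsub>K\<^esub>x\<in>carrier G. a x \<otimes>\<^bsub>K\<^esub> b (inv\<^bsub>G\<^esub> x \<otimes>\<^bsub>G\<^esub> g))"
  by (simp add: group_algebra_def)

locale finite_group_algebra = K: ring K + G: group G
  for K :: "('k, 'c) ring_scheme" and G :: "('a, 'b) monoid_scheme" +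
  assumes fin: "finite (carrier G)"
begin

abbreviation A where "A \<equiv> group_algebra K G"
abbreviation monom where "monom \<equiv> ga_monom K G"

lemma coeff_closed: "\<lbrakk>a \<in> carrier A; g \<in> carrier G\<rbrakk> \<Longrightarrow> a g \<in> carrier K"
  by auto

lemma finsum_left_translate:
  assumes "y \<in> carrier G" "\<And>x. x \<in> carrier G \<Longrightarrow> f x \<in> carrier K"
  shows "(\<Oplus>\<^bsub>K\<^esub>x\<in>carrier G. f x) = (\<Oplus>\<^bsub>K\<^esub>z\<in>carrier G. f (y \<otimes>\<^bsub>G\<^esub> z))"
proof -
  have "(\<Oplus>\<^bsub>K\<^esub>x\<in>(\<lambda>z. y \<otimes>\<^bsub>G\<^esub> z) ` carrier G. f x) = (\<Oplus>\<^bsub>K\<^esub>z\<in>carrier G. f (y \<otimes>\<^bsub>G\<^esub> z))"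
    using assms G.inj_on_cmult by (intro K.finsum_reindex) (auto simp: G.surj_const_mult)
  then show ?thesis using assms by (simp add: G.surj_const_mult)
qed

lemma finsum_delta:
  assumes "i \<in> I" "finite I" "\<And>x. x \<in> I \<Longrightarrow> f x \<in> carrier K"
  shows "(\<Oplus>\<^bsub>K\<^esub>x\<in>I. if x = i then f x else \<zero>\<^bsub>K\<^esub>) = f i"
proof -
  have "(\<lambda>x. if x = i then f x else \<zero>\<^bsub>K\<^esub>) = (\<lambda>x. if i = x then f x else \<zero>\<^bsub>K\<^esub>)" by auto
  then show ?thesis using K.finsum_singleton[of i I f] assms by simp
qed

lemma mult_closed: "\<lbrakk>a \<in> carrier A; b \<in> carrier A\<rbrakk> \<Longrightarrow> a \<otimes>\<^bsub>A\<^esub> b \<in> carrier A"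
  using coeff_closed[of a] coeff_closed[of b] by (simp add: group_algebra_mult)

text \<open>Both sides are the sum of a(y) b(z) c(w) over all y z w = g. After the sums are
  exchanged, the left translation x = y z aligns the indices.\<close>

lemma mult_assoc:
  assumes "a \<in> carrier A" "b \<in> carrier A" "c \<in> carrier A"
  shows "(a \<otimes>\<^bsub>A\<^esub> b) \<otimes>\<^bsub>A\<^esub> c = a \<otimes>\<^bsub>A\<^esub> (b \<otimes>\<^bsub>A\<^esub> c)"
  unfolding group_algebra_mult
proof (rule restrict_ext)
  fix g assume g: "g \<in> carrier G"
  note C = coeff_closed[OF assms(1)] coeff_closed[OF assms(2)] coeff_closed[OF assms(3)]
  have "(\<Oplus>\<^bsub>K\<^esub>x\<in>carrier G. (\<lambda>g\<in>carrier G. \<Oplus>\<^bsub>K\<^esub>y\<in>carrier G. a y \<otimes>\<^bsub>K\<^esub> b (inv\<^bsub>G\<^esub> y \<otimes>\<^bsub>G\<^esub> g)) x \<otimes>\<^bsub>K\<^esub> c (inv\<^bsub>G\<^esub> x \<otimes>\<^bsub>G\<^esub> g))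
      = (\<Oplus>\<^bsub>K\<^esub>x\<in>carrier G. \<Oplus>\<^bsub>K\<^esub>y\<in>carrier G. a y \<otimes>\<^bsub>K\<^esub> b (inv\<^bsub>G\<^esub> y \<otimes>\<^bsub>G\<^esub> x) \<otimes>\<^bsub>K\<^esub> c (inv\<^bsub>G\<^esub> x \<otimes>\<^bsub>G\<^esub> g))"
    using g C fin by (intro K.finsum_cong_closed) (auto simp: K.finsum_ldistr intro!: K.finsum_closed)
  also have "\<dots> = (\<Oplus>\<^bsub>K\<^esub>y\<in>carrier G. \<Oplus>\<^bsub>K\<^esub>x\<in>carrier G. a y \<otimes>\<^bsub>K\<^esub> b (inv\<^bsub>G\<^esub> y \<otimes>\<^bsub>G\<^esub> x) \<otimes>\<^bsub>K\<^esub> c (inv\<^bsub>G\<^esub> x \<otimes>\<^bsub>G\<^esub> g))"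
    using g C fin by (intro K.finsum_swap) auto
  also have "\<dots> = (\<Oplus>\<^bsub>K\<^esub>y\<in>carrier G. \<Oplus>\<^bsub>K\<^esub>z\<in>carrier G. a y \<otimes>\<^bsub>K\<^esub> (b z \<otimes>\<^bsub>K\<^esub> c (inv\<^bsub>G\<^esub> z \<otimes>\<^bsub>G\<^esub> (inv\<^bsub>G\<^esub> y \<otimes>\<^bsub>G\<^esub> g))))"
  proof (rule K.finsum_cong_closed)
    fix y assume y: "y \<in> carrier G"
    have "(\<Oplus>\<^bsub>K\<^esub>x\<in>carrier G. a y \<otimes>\<^bsub>K\<^esub> b (inv\<^bsub>G\<^esub> y \<otimes>\<^bsub>G\<^esub> x) \<otimes>\<^bsub>K\<^esub> c (inv\<^bsub>G\<^esub> x \<otimes>\<^bsub>G\<^esub> g))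
      = (\<Oplus>\<^bsub>K\<^esub>z\<in>carrier G. a y \<otimes>\<^bsub>K\<^esub> b (inv\<^bsub>G\<^esub> y \<otimes>\<^bsub>G\<^esub> (y \<otimes>\<^bsub>G\<^esub> z)) \<otimes>\<^bsub>K\<^esub> c (inv\<^bsub>G\<^esub> (y \<otimes>\<^bsub>G\<^esub> z) \<otimes>\<^bsub>G\<^esub> g))"
      using g y C by (intro finsum_left_translate) auto
    also have "\<dots> = (\<Oplus>\<^bsub>K\<^esub>z\<in>carrier G. a y \<otimes>\<^bsub>K\<^esub> (b z \<otimes>\<^bsub>K\<^esub> c (inv\<^bsub>G\<^esub> z \<otimes>\<^bsub>G\<^esub> (inv\<^bsub>G\<^esub> y \<otimes>\<^bsub>G\<^esub> g))))"
      using g y C by (intro K.finsum_cong_closed) (auto simp: G.inv_mult_group G.m_assoc K.m_assoc G.m_assoc[symmetric, of "inv\<^bsub>G\<^esub> y" y])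
    finally show "(\<Oplus>\<^bsub>K\<^esub>x\<in>carrier G. a y \<otimes>\<^bsub>K\<^esub> b (inv\<^bsub>G\<^esub> y \<otimes>\<^bsub>G\<^esub> x) \<otimes>\<^bsub>K\<^esub> c (inv\<^bsub>G\<^esub> x \<otimes>\<^bsub>G\<^esub> g)) = \<dots>" .
  qed (use g C in \<open>auto intro!: K.finsum_closed\<close>)
  also have "\<dots> = (\<Oplus>\<^bsub>K\<^esub>y\<in>carrier G. a y \<otimes>\<^bsub>K\<^esub> (\<lambda>g\<in>carrier G. \<Oplus>\<^bsub>K\<^esub>z\<in>carrier G. b z \<otimes>\<^bsub>K\<^esub> c (inv\<^bsub>G\<^esub> z \<otimes>\<^bsub>G\<^esub> g)) (inv\<^bsub>G\<^esub> y \<otimes>\<^bsub>G\<^esub> g))"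
    using g C fin by (intro K.finsum_cong_closed) (auto simp: K.finsum_rdistr intro!: K.finsum_closed)
  finally show "(\<Oplus>\<^bsub>K\<^esub>x\<in>carrier G. (\<lambda>g\<in>carrier G. \<Oplus>\<^bsub>K\<^esub>x\<in>carrier G. a x \<otimes>\<^bsub>K\<^esub> b (inv\<^bsub>G\<^esub> x \<otimes>\<^bsub>G\<^esub> g)) x \<otimes>\<^bsub>K\<^esub> c (inv\<^bsub>G\<^esub> x \<otimes>\<^bsub>G\<^esub> g))
     = (\<Oplus>\<^bsub>K\<^esub>x\<in>carrier G. a x \<otimes>\<^bsub>K\<^esub> (\<lambda>g\<in>carrier G. \<Oplus>\<^bsub>K\<^esub>x\<in>carrier G. b x \<otimes>\<^bsub>K\<^esub> c (inv\<^bsub>G\<^esub> x \<otimes>\<^bsub>G\<^esub> g)) (inv\<^bsub>G\<^esub> x \<otimes>\<^bsub>G\<^esub> g))" .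
qed

lemma one_mult:
  assumes "a \<in> carrier A"
  shows "\<one>\<^bsub>A\<^esub> \<otimes>\<^bsub>A\<^esub> a = a"
proof
  fix g
  show "(\<one>\<^bsub>A\<^esub> \<otimes>\<^bsub>A\<^esub> a) g = a g"
  proof (cases "g \<in> carrier G")
    case True
    note C = coeff_closed[OF assms]
    have "(\<one>\<^bsub>A\<^esub> \<otimes>\<^bsub>A\<^esub> a) g = (\<Oplus>\<^bsub>K\<^esub>x\<in>carrier G. if x = \<one>\<^bsub>G\<^esub> then a (inv\<^bsub>G\<^esub> x \<otimes>\<^bsub>G\<^esub> g) else \<zero>\<^bsub>K\<^esub>)"
      using C True by (auto simp: group_algebra_mult intro!: K.finsum_cong_closed)
    also have "\<dots> = a g" using C True fin by (subst finsum_delta) auto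
    finally show ?thesis .
  qed (use assms in \<open>simp add: group_algebra_mult PiE_arb[of a]\<close>)
qed

lemma mult_one:
  assumes "a \<in> carrier A"
  shows "a \<otimes>\<^bsub>A\<^esub> \<one>\<^bsub>A\<^esub> = a"
proof
  fix g
  show "(a \<otimes>\<^bsub>A\<^esub> \<one>\<^bsub>A\<^esub>) g = a g"
  proof (cases "g \<in> carrier G")
    case True
    note C = coeff_closed[OF assms]
    have "inv\<^bsub>G\<^esub> x \<otimes>\<^bsub>G\<^esub> g = \<one>\<^bsub>G\<^esub> \<longleftrightarrow> x = g" if "x \<in> carrier G" for x
      using that True by (metis G.inv_inv G.inv_closed G.inv_equality G.l_inv)
    then have "(a \<otimes>\<^bsub>A\<^esub> \<one>\<^bsub>A\<^esub>) g = (\<Oplus>\<^bsub>K\<^esub>x\<in>carrier G. if x = g then a x else \<zero>\<^bsub>K\<^esub>)"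
      using C True by (auto simp: group_algebra_mult intro!: K.finsum_cong_closed)
    also have "\<dots> = a g" using C True fin by (subst finsum_delta) auto
    finally show ?thesis .
  qed (use assms in \<open>simp add: group_algebra_mult PiE_arb[of a]\<close>)
qed

lemma abelian_group_algebra: "abelian_group A"
  by (rule PiE_abelian_group[of K]) (simp_all add: K.is_abelian_group)

lemma ring_group_algebra: "ring A"
proof (rule ringI)
  show "abelian_group A" by (rule abelian_group_algebra)
  show "monoid A"
    using mult_closed mult_assoc one_mult mult_one by (intro monoidI) auto
next
  fix a b c assume abc: "a \<in> carrier A" "b \<in> carrier A" "c \<in> carrier A"
  note C = coeff_closed[OF abc(1)] coeff_closed[OF abc(2)] coeff_closed[OF abc(3)]
  show "(a \<oplus>\<^bsub>A\<^esub> b) \<otimes>\<^bsub>A\<^esub> c = a \<otimes>\<^bsub>A\<^esub> c \<oplus>\<^bsub>A\<^esub> b \<otimes>\<^bsub>A\<^esub> c"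
  proof -
    have "(\<Oplus>\<^bsub>K\<^esub>x\<in>carrier G. (\<lambda>g\<in>carrier G. a g \<oplus>\<^bsub>K\<^esub> b g) x \<otimes>\<^bsub>K\<^esub> c (inv\<^bsub>G\<^esub> x \<otimes>\<^bsub>G\<^esub> g))
        = (\<Oplus>\<^bsub>K\<^esub>x\<in>carrier G. a x \<otimes>\<^bsub>K\<^esub> c (inv\<^bsub>G\<^esub> x \<otimes>\<^bsub>G\<^esub> g)) \<oplus>\<^bsub>K\<^esub>
          (\<Oplus>\<^bsub>K\<^esub>x\<in>carrier G. b x \<otimes>\<^bsub>K\<^esub> c (inv\<^bsub>G\<^esub> x \<otimes>\<^bsub>G\<^esub> g))" if "g \<in> carrier G" for g
    proof -
      have "(\<Oplus>\<^bsub>K\<^esub>x\<in>carrier G. (\<lambda>g\<in>carrier G. a g \<oplus>\<^bsub>K\<^esub> b g) x \<otimes>\<^bsub>K\<^esub> c (inv\<^bsub>G\<^esub> x \<otimes>\<^bsub>G\<^esub> g))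
        = (\<Oplus>\<^bsub>K\<^esub>x\<in>carrier G. a x \<otimes>\<^bsub>K\<^esub> c (inv\<^bsub>G\<^esub> x \<otimes>\<^bsub>G\<^esub> g) \<oplus>\<^bsub>K\<^esub> b x \<otimes>\<^bsub>K\<^esub> c (inv\<^bsub>G\<^esub> x \<otimes>\<^bsub>G\<^esub> g))"
        using C that by (intro K.finsum_cong_closed) (simp_all add: K.l_distr)
      then show ?thesis using C that by (simp add: K.finsum_addf Pi_iff)
    qed
    then show ?thesis by (auto simp: group_algebra_mult intro!: restrict_ext)
  qed
  show "c \<otimes>\<^bsub>A\<^esub> (a \<oplus>\<^bsub>A\<^esub> b) = c \<otimes>\<^bsub>A\<^esub> a \<oplus>\<^bsub>A\<^esub> c \<otimes>\<^bsub>A\<^esub> b"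
  proof -
    have "(\<Oplus>\<^bsub>K\<^esub>x\<in>carrier G. c x \<otimes>\<^bsub>K\<^esub> (\<lambda>g\<in>carrier G. a g \<oplus>\<^bsub>K\<^esub> b g) (inv\<^bsub>G\<^esub> x \<otimes>\<^bsub>G\<^esub> g))
        = (\<Oplus>\<^bsub>K\<^esub>x\<in>carrier G. c x \<otimes>\<^bsub>K\<^esub> a (inv\<^bsub>G\<^esub> x \<otimes>\<^bsub>G\<^esub> g)) \<oplus>\<^bsub>K\<^esub>
          (\<Oplus>\<^bsub>K\<^esub>x\<in>carrier G. c x \<otimes>\<^bsub>K\<^esub> b (inv\<^bsub>G\<^esub> x \<otimes>\<^bsub>G\<^esub> g))" if "g \<in> carrier G" for g
    proof -
      have "(\<Oplus>\<^bsub>K\<^esub>x\<in>carrier G. c x \<otimes>\<^bsub>K\<^esub> (\<lambda>g\<in>carrier G. a g \<oplus>\<^bsub>K\<^esub> b g) (inv\<^bsub>G\<^esub> x \<otimes>\<^bsub>G\<^esub> g))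
        = (\<Oplus>\<^bsub>K\<^esub>x\<in>carrier G. c x \<otimes>\<^bsub>K\<^esub> a (inv\<^bsub>G\<^esub> x \<otimes>\<^bsub>G\<^esub> g) \<oplus>\<^bsub>K\<^esub> c x \<otimes>\<^bsub>K\<^esub> b (inv\<^bsub>G\<^esub> x \<otimes>\<^bsub>G\<^esub> g))"
        using C that by (intro K.finsum_cong_closed) (simp_all add: K.r_distr)
      then show ?thesis using C that by (simp add: K.finsum_addf Pi_iff)
    qed
    then show ?thesis by (auto simp: group_algebra_mult intro!: restrict_ext)
  qed
qed

section \<open>Monomials in the group algebra\<close>

lemma monom_closed: "c \<in> carrier K \<Longrightarrow> monom c g \<in> carrier A"
  by (auto simp: ga_monom_def)

lemma monom_apply: "x \<in> carrier G \<Longrightarrow> monom c g x = (if x = g then c else \<zero>\<^bsub>K\<^esub>)"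
  by (simp add: ga_monom_def)

lemma monom_one: "monom \<one>\<^bsub>K\<^esub> \<one>\<^bsub>G\<^esub> = \<one>\<^bsub>A\<^esub>"
  by (simp add: ga_monom_def)

lemma monom_zero: "monom \<zero>\<^bsub>K\<^esub> g = \<zero>\<^bsub>A\<^esub>"
  by (auto simp: ga_monom_def)

lemma monom_add:
  "\<lbrakk>c \<in> carrier K; c' \<in> carrier K\<rbrakk> \<Longrightarrow> monom (c \<oplus>\<^bsub>K\<^esub> c') g = monom c g \<oplus>\<^bsub>A\<^esub> monom c' g"
  by (auto simp: ga_monom_def intro!: restrict_ext)

lemma monom_mult:
  assumes "c \<in> carrier K" "c' \<in> carrier K" "g \<in> carrier G" "g' \<in> carrier G"
  shows "monom c g \<otimes>\<^bsub>A\<^esub> monom c' g' = monom (c \<otimes>\<^bsub>K\<^esub> c') (g \<otimes>\<^bsub>G\<^esub> g')"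
  unfolding group_algebra_mult ga_monom_def[of _ _ "c \<otimes>\<^bsub>K\<^esub> c'"]
proof (rule restrict_ext)
  fix x assume x: "x \<in> carrier G"
  have "(\<Oplus>\<^bsub>K\<^esub>y\<in>carrier G. monom c g y \<otimes>\<^bsub>K\<^esub> monom c' g' (inv\<^bsub>G\<^esub> y \<otimes>\<^bsub>G\<^esub> x))
     = (\<Oplus>\<^bsub>K\<^esub>y\<in>carrier G. if y = g then c \<otimes>\<^bsub>K\<^esub> (if inv\<^bsub>G\<^esub> y \<otimes>\<^bsub>G\<^esub> x = g' then c' else \<zero>\<^bsub>K\<^esub>) else \<zero>\<^bsub>K\<^esub>)"
    using x assms by (intro K.finsum_cong_closed) (auto simp: monom_apply)
  also have "\<dots> = c \<otimes>\<^bsub>K\<^esub> (if inv\<^bsub>G\<^esub> g \<otimes>\<^bsub>G\<^esub> x = g' then c' else \<zero>\<^bsub>K\<^esub>)"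
    using assms fin by (subst finsum_delta) auto
  also have "inv\<^bsub>G\<^esub> g \<otimes>\<^bsub>G\<^esub> x = g' \<longleftrightarrow> x = g \<otimes>\<^bsub>G\<^esub> g'"
    using assms x G.inv_solve_left' by metis
  finally show "(\<Oplus>\<^bsub>K\<^esub>y\<in>carrier G. monom c g y \<otimes>\<^bsub>K\<^esub> monom c' g' (inv\<^bsub>G\<^esub> y \<otimes>\<^bsub>G\<^esub> x))
     = (if x = g \<otimes>\<^bsub>G\<^esub> g' then c \<otimes>\<^bsub>K\<^esub> c' else \<zero>\<^bsub>K\<^esub>)" using assms by simp
qed

text \<open>Applied to KH, this reduces the stability of a vector under F_iKH to its stability under
  multiples of single group elements.\<close>

lemma finsum_monom:
  assumes "a \<in> carrier A"
  shows "(\<Oplus>\<^bsub>A\<^esub>g\<in>carrier G. monom (a g) g) = a"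
proof
  interpret A: abelian_group A by (rule abelian_group_algebra)
  note C = coeff_closed[OF assms]
  have cl: "(\<Oplus>\<^bsub>A\<^esub>g\<in>carrier G. monom (a g) g) \<in> carrier A"
    using C by (intro A.finsum_closed) (auto simp: ga_monom_def)
  fix x
  show "(\<Oplus>\<^bsub>A\<^esub>g\<in>carrier G. monom (a g) g) x = a x"
  proof (cases "x \<in> carrier G")
    case True
    have "(\<Oplus>\<^bsub>A\<^esub>g\<in>carrier G. monom (a g) g) x = (\<Oplus>\<^bsub>K\<^esub>g\<in>carrier G. monom (a g) g x)"
      using True C fin by (intro PiE_finsum_apply) (auto simp: K.is_abelian_group ga_monom_def)
    also have "\<dots> = (\<Oplus>\<^bsub>K\<^esub>g\<in>carrier G. if g = x then a g else \<zero>\<^bsub>K\<^esub>)"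
      using True C by (intro K.finsum_cong_closed) (auto simp: monom_apply)
    also have "\<dots> = a x" using True C fin by (intro finsum_delta) auto
    finally show ?thesis .
  qed (use PiE_arb[OF cl[simplified]] PiE_arb[of a] assms in simp)
qed

end

section \<open>The filtration of a group algebra\<close>

locale filtered_group_algebra = finite_group_algebra K G
  for K :: "('k, 'c) ring_scheme" and G :: "('a, 'b) monoid_scheme" +
  fixes Gs :: "nat \<Rightarrow> 'a set" and d :: nat
  assumes chain_subgroup: "i \<le> d \<Longrightarrow> subgroup (Gs i) G"
    and chain_mono: "i < d \<Longrightarrow> Gs i \<subseteq> Gs (Suc i)"
    and chain_top: "Gs d = carrier G"
begin

abbreviation F where "F \<equiv> ga_filtration K G Gs d"
text \<open>Cutting the index off at \<open>d\<close> lets a single support condition describe both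
  cases of \<open>ga_filtration\<close>, because \<open>Gs d\<close> is the whole group.\<close>

abbreviation Gm where "Gm n \<equiv> Gs (min n d)"

lemma Gm_subgroup: "subgroup (Gm n) G"
  by (simp add: chain_subgroup)

lemma Gm_subset: "Gm n \<subseteq> carrier G"
  using Gm_subgroup subgroup.subset by blast

lemma Gm_mono:
  assumes "m \<le> n"
  shows "Gm m \<subseteq> Gm n"
proof -
  have "Gs i \<subseteq> Gs j" if "i \<le> j" "j \<le> d" for i j
    using that
  proof (induction j rule: dec_induct)
    case (step n)
    then show ?case using chain_mono[of n] by simp
  qed simp
  then show ?thesis using assms by simp
qed

lemma filtration_iff:
  "a \<in> F n \<longleftrightarrow> a \<in> carrier A \<and> (\<forall>g\<in>carrier G - Gm n. a g = \<zero>\<^bsub>K\<^esub>)"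
  by (auto simp: ga_filtration_def chain_top min_def)

lemma filtration_carrier: "a \<in> F n \<Longrightarrow> a \<in> carrier A"
  using filtration_iff by blast

lemma filtration_mono: "m \<le> n \<Longrightarrow> F m \<subseteq> F n"
  using Gm_mono[of m n] unfolding subset_iff filtration_iff by blast

lemma monom_in_filtration: "\<lbrakk>c \<in> carrier K; g \<in> Gm n\<rbrakk> \<Longrightarrow> monom c g \<in> F n"
  using monom_closed[of c g] by (auto simp: filtration_iff monom_apply)

text \<open>If g lies outside the subgroup \<open>Gm n\<close>, then x and x^-1 g cannot both lie in
  it, so every summand of the coefficient at g vanishes. The target index is free, and not fixed to
  i + j, because (f3) speaks of every \<mu> that absorbs the product.\<close>

lemma filtration_mult_closed:
  assumes "a \<in> F i" "b \<in> F j" "Gm i \<subseteq> Gm n" "Gm j \<subseteq> Gm n"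
  shows "a \<otimes>\<^bsub>A\<^esub> b \<in> F n"
  unfolding filtration_iff
proof (intro conjI ballI)
  interpret S: subgroup "Gm n" G by (rule Gm_subgroup)
  note ab = filtration_carrier[OF assms(1)] filtration_carrier[OF assms(2)]
  show "a \<otimes>\<^bsub>A\<^esub> b \<in> carrier A" using ab by (rule mult_closed)
  fix g assume g: "g \<in> carrier G - Gm n"
  have "a x \<otimes>\<^bsub>K\<^esub> b (inv\<^bsub>G\<^esub> x \<otimes>\<^bsub>G\<^esub> g) = \<zero>\<^bsub>K\<^esub>" if x: "x \<in> carrier G" for x
  proof (cases "x \<in> Gm n")
    case True
    have "inv\<^bsub>G\<^esub> x \<otimes>\<^bsub>G\<^esub> g \<notin> Gm n"
      using True g x S.m_closed[of x "inv\<^bsub>G\<^esub> x \<otimes>\<^bsub>G\<^esub> g"] by (auto simp: G.m_assoc[symmetric])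
    then have "b (inv\<^bsub>G\<^esub> x \<otimes>\<^bsub>G\<^esub> g) = \<zero>\<^bsub>K\<^esub>"
      using assms(2,4) g x by (auto simp: filtration_iff)
    then show ?thesis using coeff_closed[OF ab(1) x] by simp
  next
    case False
    then have "a x = \<zero>\<^bsub>K\<^esub>" using assms(1,3) x by (auto simp: filtration_iff)
    then show ?thesis using coeff_closed[OF ab(2)] g x by simp
  qed
  then show "(a \<otimes>\<^bsub>A\<^esub> b) g = \<zero>\<^bsub>K\<^esub>"
    using g by (simp add: group_algebra_mult K.add.finprod_one_eqI)
qed

lemma positive_filtration: "positive_filtration A F"
proof -
  interpret A: ring A by (rule ring_group_algebra)
  show ?thesis
  proof (intro positive_filtration.intro positive_filtration_axioms.intro ring_group_algebra)
    fix i j a b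
    show "subgroup (F i) (add_monoid A)"
    proof (rule group.subgroupI[OF A.a_group])
      show "F i \<subseteq> carrier (add_monoid A)" using filtration_carrier by auto
      have "\<zero>\<^bsub>A\<^esub> \<in> F i" using A.zero_closed unfolding filtration_iff by simp
      then show "F i \<noteq> {}" by blast
    next
      fix a assume a: "a \<in> F i"
      have "(\<ominus>\<^bsub>A\<^esub> a) g = \<zero>\<^bsub>K\<^esub>" if "g \<in> carrier G - Gm i" for g
      proof -
        \<comment> \<open>There is no formula for negatives in the group algebra at hand; the
          coefficient is read off from -a + a = 0.\<close>
        have "(\<ominus>\<^bsub>A\<^esub> a \<oplus>\<^bsub>A\<^esub> a) g = \<zero>\<^bsub>A\<^esub> g"
          using A.l_neg[OF filtration_carrier[OF a]] by simp
        moreover have "(\<ominus>\<^bsub>A\<^esub> a) g \<in> carrier K"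
          using that coeff_closed A.a_inv_closed[OF filtration_carrier[OF a]] by blast
        ultimately show ?thesis using a that by (simp add: filtration_iff)
      qed
      then show "inv\<^bsub>add_monoid A\<^esub> a \<in> F i"
        using A.a_inv_closed[OF filtration_carrier[OF a]]
        unfolding filtration_iff a_inv_def[symmetric] by blast
    next
      fix a b assume "a \<in> F i" "b \<in> F i"
      then show "a \<otimes>\<^bsub>add_monoid A\<^esub> b \<in> F i"
        using A.a_closed[of a b] unfolding filtration_iff by simp
    qed
    show "F i \<subseteq> F (Suc i)" by (rule filtration_mono) simp
    show "a \<otimes>\<^bsub>A\<^esub> b \<in> F (i + j)" if "a \<in> F i" "b \<in> F j"
      using that by (rule filtration_mult_closed) (intro Gm_mono, simp)+
    have "\<one>\<^bsub>G\<^esub> \<in> Gm 0" using Gm_subgroup by (rule subgroup.one_closed)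
    then show "\<one>\<^bsub>A\<^esub> \<in> F 0" using monom_in_filtration[OF K.one_closed] monom_one by metis
  qed
qed

end

lemma (in positive_filtration) filtration_0_ring: "ring (R\<lparr>carrier := F 0\<rparr>)"
proof (rule subring_is_ring, rule subringI)
  note S = filt_subgroup[of 0]
  show "F 0 \<subseteq> carrier R" using subgroup.subset[OF S] by simp
  show "\<ominus> h \<in> F 0" if "h \<in> F 0" for h
    using subgroup.m_inv_closed[OF S that] by (simp add: a_inv_def)
  show "h \<oplus> k \<in> F 0" "h \<otimes> k \<in> F 0" if "h \<in> F 0" "k \<in> F 0" for h k
    using subgroup.m_closed[OF S that] filt_mult[OF that] by simp_all
qed (rule filt_one)

lemma (in group) left_mult_image_subgroup:
  assumes "subgroup S G" "x \<in> S"
  shows "(\<lambda>z. x \<otimes> z) ` S = S"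
  using group.surj_const_mult[OF subgroup.subgroup_is_group[OF assms(1) is_group]] assms(2) by simp

text \<open>Normality is known only one step up the chain, so the induction descends from the top
  term, which is the whole group.\<close>

lemma (in group) normal_chain_subgroup:
  assumes "normal_chain G Gs d" "i \<le> d"
  shows "subgroup (Gs i) G"
  using assms(2)
proof (induction i rule: inc_induct)
  case base
  then show ?case using assms(1) subgroup_self by (simp add: normal_chain_def)
next
  case (step n)
  then have "subgroup (Gs n) (G\<lparr>carrier := Gs (Suc n)\<rparr>)"
    using assms(1) by (simp add: normal_chain_def normal_imp_subgroup)
  then show ?case using step incl_subgroup by blast
qed

section \<open>Cosets, transversal and cocycle\<close>

locale induction_datum =
  fixes K :: "('k, 'c) ring_scheme"
    and G :: "('a, 'b) monoid_scheme"
    and H :: "'a set"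
    and Gs T :: "nat \<Rightarrow> 'a set"
    and d :: nat
  assumes field: "field K"
    and group: "group G"
    and finite: "finite (carrier G)"
    and d_pos: "1 \<le> d"
    and chain: "normal_chain G Gs d"
    and H_normal: "H \<lhd> G"
    and H_chain_normal: "\<forall>i\<le>d. H \<inter> Gs i \<lhd> G"
    and transversal: "ascending_transversal G H Gs d T"
    and filtered: "filtered_cocycle G H Gs d T"
begin

sublocale K: field K by (rule field)
sublocale G: group G by (rule group)
sublocale H: normal H G by (rule H_normal)
sublocale Q: group "G Mod H" by (rule H.factorgroup_is_group)

sublocale GA: filtered_group_algebra K G Gs d
proof (intro filtered_group_algebra.intro finite_group_algebra.intro
    finite_group_algebra_axioms.intro filtered_group_algebra_axioms.intro K.ring_axioms group)
  fix i
  show "Gs i \<subseteq> Gs (Suc i)" if "i < d"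
    using chain that subgroup.subset[OF normal_imp_subgroup[of "Gs i" "G\<lparr>carrier := Gs (Suc i)\<rparr>"]]
    by (simp add: normal_chain_def)
qed (use chain finite G.normal_chain_subgroup[OF chain] in \<open>auto simp: normal_chain_def\<close>)

text \<open>With H in place of G, \<open>HA.Gm j\<close> is literally
  \<open>H \<inter> GA.Gm j\<close>; inclusions between the G_i pass to the H_i by mere
  intersection.\<close>

sublocale HA: filtered_group_algebra K "G\<lparr>carrier := H\<rparr>" "\<lambda>i. H \<inter> Gs i" d
proof -
  have HG: "group (G\<lparr>carrier := H\<rparr>)" by (rule H.subgroup_is_group) (rule group)
  show "filtered_group_algebra K (G\<lparr>carrier := H\<rparr>) (\<lambda>i. H \<inter> Gs i) d"
  proof (intro filtered_group_algebra.intro finite_group_algebra.intro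
    finite_group_algebra_axioms.intro filtered_group_algebra_axioms.intro K.ring_axioms HG)
    fix i
    show "subgroup (H \<inter> Gs i) (G\<lparr>carrier := H\<rparr>)" if "i \<le> d"
      using G.subgroup_incl[OF normal_imp_subgroup H.subgroup_axioms] H_chain_normal that by simp
    show "H \<inter> Gs i \<subseteq> H \<inter> Gs (Suc i)" if "i < d" using GA.chain_mono[OF that] by blast
  qed (use H.subset GA.chain_top finite in \<open>auto intro: finite_subset\<close>)
qed

abbreviation \<pi> where "\<pi> g \<equiv> H #>\<^bsub>G\<^esub> g"
abbreviation \<sigma> where "\<sigma> \<equiv> section_of (T d)"
abbreviation translate (infixr "\<rhd>" 75) where "g \<rhd> X \<equiv> \<pi> g <#>\<^bsub>G\<^esub> X"

text \<open>This is the usual factor of an induced representation, a 1-cocycle on G x G/H. Unlike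
  the 2-cocycle \<open>cocycle\<close>, it depends on g itself and not only on the coset of
  g.\<close>

definition \<kappa> where "\<kappa> g X = inv\<^bsub>G\<^esub> \<sigma> (g \<rhd> X) \<otimes>\<^bsub>G\<^esub> (g \<otimes>\<^bsub>G\<^esub> \<sigma> X)"

section \<open>Translation of cosets by group elements\<close>

lemma coset_cases:
  assumes "X \<in> carrier (G Mod H)"
  obtains g where "g \<in> carrier G" "X = \<pi> g"
  using assms by (auto simp: carrier_FactGroup)

lemma \<pi>_closed: "g \<in> carrier G \<Longrightarrow> \<pi> g \<in> carrier (G Mod H)"
  by (auto simp: carrier_FactGroup)

lemma translate_closed:
  "\<lbrakk>g \<in> carrier G; X \<in> carrier (G Mod H)\<rbrakk> \<Longrightarrow> g \<rhd> X \<in> carrier (G Mod H)"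
  using Q.m_closed[OF \<pi>_closed] by simp

lemma translate_mult:
  "\<lbrakk>g \<in> carrier G; g' \<in> carrier G; X \<in> carrier (G Mod H)\<rbrakk> \<Longrightarrow>
    (g \<otimes>\<^bsub>G\<^esub> g') \<rhd> X = g \<rhd> g' \<rhd> X"
  using Q.m_assoc[OF \<pi>_closed \<pi>_closed] by (simp add: H.rcos_sum)

lemma translate_one: "X \<in> carrier (G Mod H) \<Longrightarrow> \<one>\<^bsub>G\<^esub> \<rhd> X = X"
  using Q.l_one by (simp add: G.coset_mult_one[OF H.subset])

lemma translate_inv [simp]:
  assumes "g \<in> carrier G" "X \<in> carrier (G Mod H)"
  shows "g \<rhd> inv\<^bsub>G\<^esub> g \<rhd> X = X" "inv\<^bsub>G\<^esub> g \<rhd> g \<rhd> X = X"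
  using assms translate_one by (simp_all add: translate_mult[symmetric])

lemma translate_H: "\<lbrakk>g \<in> H; X \<in> carrier (G Mod H)\<rbrakk> \<Longrightarrow> g \<rhd> X = X"
  using Q.l_one[of X] G.coset_join2[OF _ H.subgroup_axioms, of g] by simp

text \<open>Normality of H bridges the left cosets that occur in
  \<open>ascending_transversal\<close> and the right cosets that form
  \<open>G Mod H\<close>.\<close>

lemma mem_coset_iff:
  assumes "g \<in> carrier G" "t \<in> carrier G"
  shows "g \<in> t <#\<^bsub>G\<^esub> H \<longleftrightarrow> t \<in> \<pi> g"
  using assms G.repr_independence[OF _ _ H.subgroup_axioms] G.rcos_self[OF _ H.subgroup_axioms]
    H.coset_eq by metis

section \<open>The section and its compatibility with the chain\<close>

lemma transversal_mono:
  assumes "1 \<le> i" "i \<le> d"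
  shows "T i \<subseteq> T d"
  using assms(2,1)
proof (induction i rule: inc_induct)
  case (step n)
  then have "T n \<subseteq> T (Suc n)" using transversal by (simp add: ascending_transversal_def)
  then show ?case using step by simp
qed simp

lemma transversal_subset: "T d \<subseteq> carrier G"
  using transversal d_pos unfolding ascending_transversal_def GA.chain_top[symmetric] by blast

lemma section_unique:
  assumes "t \<in> T d" "t \<in> X" "X \<in> carrier (G Mod H)"
  shows "\<sigma> X = t"
  unfolding section_of_def
proof (rule the_equality)
  show "t \<in> T d \<and> t \<in> X" using assms by simp
  fix t' assume t': "t' \<in> T d \<and> t' \<in> X"
  obtain g where g: "g \<in> carrier G" "X = \<pi> g" using assms(3) by (rule coset_cases)
  \<comment> \<open>At index d the transversal condition concerns cosets of all of H, because H
    \<inter> G_d = H. Its uniqueness part then identifies \<open>t'\<close> with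
    \<open>t\<close>.\<close>
  have "\<exists>!t. t \<in> T d \<and> g \<in> t <#\<^bsub>G\<^esub> (H \<inter> Gs d)"
    using transversal d_pos g(1) GA.chain_top unfolding ascending_transversal_def by blast
  moreover have "H \<inter> Gs d = H" using GA.chain_top H.subset by blast
  ultimately show "t' = t"
    using t' assms(1,2) g transversal_subset mem_coset_iff[OF g(1)] by (metis subsetD)
qed

text \<open>A representative chosen in \<open>T i\<close> also lies in \<open>T d\<close>, and
  \<open>T d\<close> meets each coset of H only once. So the section defined by \<open>T d\<close>
  already picks the element of \<open>T i\<close> on cosets that meet G_i.\<close>

lemma section_in_coset:
  assumes "1 \<le> i" "i \<le> d" "g \<in> Gs i"
  shows "\<sigma> (\<pi> g) \<in> T i \<inter> \<pi> g"
proof -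
  have gG: "g \<in> carrier G" using assms GA.chain_subgroup subgroup.mem_carrier by metis
  obtain t where t: "t \<in> T i" "g \<in> t <#\<^bsub>G\<^esub> (H \<inter> Gs i)"
    using transversal assms unfolding ascending_transversal_def by metis
  have tT: "t \<in> T d" using transversal_mono t assms by blast
  moreover have "t \<in> \<pi> g"
    using t tT transversal_subset mem_coset_iff[OF gG, of t] by (auto simp: l_coset_def)
  ultimately show ?thesis using section_unique[OF _ _ \<pi>_closed[OF gG]] t by simp
qed

lemma section_one: "\<sigma> H = \<one>\<^bsub>G\<^esub>"
proof (rule section_unique)
  show "\<one>\<^bsub>G\<^esub> \<in> T d"
    using transversal transversal_mono[of 1] d_pos by (auto simp: ascending_transversal_def)
  show "H \<in> carrier (G Mod H)" using Q.one_closed by simp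
qed (rule H.one_closed)

lemma section_filtered:
  assumes "g \<in> GA.Gm j"
  shows "\<sigma> (\<pi> g) \<in> GA.Gm j"
proof (cases "j = 0")
  \<comment> \<open>The transversals start at index 1, so level 0 is separate: G_0 is trivial, and
    the section of the coset H is 1.\<close>
  case True
  then show ?thesis
    using assms chain section_one G.coset_mult_one[OF H.subset] by (simp add: normal_chain_def)
next
  case False
  then have "\<sigma> (\<pi> g) \<in> T (min j d)" using section_in_coset[of "min j d"] assms d_pos by simp
  moreover have "1 \<le> min j d" using d_pos False by simp
  ultimately show ?thesis
    using transversal unfolding ascending_transversal_def by (meson min.cobounded2 subsetD)
qed

lemma section_closed:
  assumes "X \<in> carrier (G Mod H)"
  shows "\<sigma> X \<in> carrier G" "\<pi> (\<sigma> X) = X"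
proof -
  obtain g where g: "g \<in> carrier G" "X = \<pi> g" using assms by (rule coset_cases)
  have *: "\<sigma> X \<in> T d \<inter> \<pi> g" using section_in_coset[of d] g d_pos GA.chain_top by simp
  then show "\<sigma> X \<in> carrier G" using transversal_subset by blast
  show "\<pi> (\<sigma> X) = X" using * g G.repr_independence[OF _ _ H.subgroup_axioms] by auto
qed

text \<open>Put t = \<sigma>(X) and g = t1 h1 with t1 = \<sigma>(\<pi> g). The cocycle ends in t1 t,
  which followed by t^-1 h1 t collapses to t1 h1 t = g t. The two factors in the definition of the
  action thus amount to one factor \<open>\<kappa> g X\<close>.\<close>

lemma \<kappa>_eq_cocycle:
  assumes "g \<in> carrier G" "X \<in> carrier (G Mod H)"
  shows "cocycle G (T d) (\<pi> g) X \<otimes>\<^bsub>G\<^esub> (inv\<^bsub>G\<^esub> \<sigma> X \<otimes>\<^bsub>G\<^esub> (inv\<^bsub>G\<^esub> \<sigma> (\<pi> g) \<otimes>\<^bsub>G\<^esub> g) \<otimes>\<^bsub>G\<^esub> \<sigma> X) = \<kappa> g X"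
proof -
  have cancel: "x \<otimes>\<^bsub>G\<^esub> (inv\<^bsub>G\<^esub> x \<otimes>\<^bsub>G\<^esub> y) = y" if "x \<in> carrier G" "y \<in> carrier G" for x y
    using that by (simp add: G.m_assoc[symmetric])
  have "\<sigma> (g \<rhd> X) \<in> carrier G" "\<sigma> X \<in> carrier G" "\<sigma> (\<pi> g) \<in> carrier G"
    using assms section_closed(1) translate_closed \<pi>_closed by blast+
  then show ?thesis using assms(1) by (simp add: cocycle_def \<kappa>_def G.m_assoc cancel)
qed

text \<open>Here the split form of the factor is the useful one. The cocycle lies in H_j since it is
  filtered. The element h1 = t1^-1 g lies in G_j since t1 does, and in H since t1 represents the
  coset of g. The conjugating element \<sigma>(X) ranges over all of G, which is why H_j must be
  normal in G.\<close>

lemma \<kappa>_closed: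
  assumes g: "g \<in> GA.Gm j" and X: "X \<in> carrier (G Mod H)"
  shows "\<kappa> g X \<in> H \<inter> GA.Gm j"
proof -
  interpret Hj: normal "H \<inter> GA.Gm j" G using H_chain_normal by simp
  interpret Gj: subgroup "GA.Gm j" G by (rule GA.Gm_subgroup)
  have gG: "g \<in> carrier G" using g by (rule Gj.mem_carrier)
  obtain x where x: "x \<in> carrier G" "X = \<pi> x" using X by (rule coset_cases)
  have "cocycle G (T d) (\<pi> g) X \<in> H \<inter> GA.Gm j"
    using filtered g x unfolding filtered_cocycle_def by (metis min.cobounded2)
  moreover have "inv\<^bsub>G\<^esub> \<sigma> (\<pi> g) \<otimes>\<^bsub>G\<^esub> g \<in> H \<inter> GA.Gm j"
  proof
    show "inv\<^bsub>G\<^esub> \<sigma> (\<pi> g) \<otimes>\<^bsub>G\<^esub> g \<in> GA.Gm j"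
      using section_filtered[OF g] g by (intro Gj.m_closed Gj.m_inv_closed)
    note s = section_closed[OF \<pi>_closed[OF gG]]
    have "g \<in> \<pi> (\<sigma> (\<pi> g))" using s(2) G.rcos_self[OF gG H.subgroup_axioms] by simp
    then have "g \<in> \<sigma> (\<pi> g) <#\<^bsub>G\<^esub> H" using H.coset_eq s(1) by simp
    then obtain x where x: "x \<in> H" "g = \<sigma> (\<pi> g) \<otimes>\<^bsub>G\<^esub> x" by (auto simp: l_coset_def)
    then have "x = inv\<^bsub>G\<^esub> \<sigma> (\<pi> g) \<otimes>\<^bsub>G\<^esub> g"
      using s(1) gG H.subset G.inv_solve_left by blast
    then show "inv\<^bsub>G\<^esub> \<sigma> (\<pi> g) \<otimes>\<^bsub>G\<^esub> g \<in> H" using x(1) by simp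
  qed
  ultimately show ?thesis
    unfolding \<kappa>_eq_cocycle[OF gG X, symmetric]
    by (rule Hj.m_closed[OF _ Hj.inv_op_closed1[OF section_closed(1)[OF X]]])
qed

lemma \<kappa>_one: "X \<in> carrier (G Mod H) \<Longrightarrow> \<kappa> \<one>\<^bsub>G\<^esub> X = \<one>\<^bsub>G\<^esub>"
  using section_closed(1) by (simp add: \<kappa>_def translate_one)

lemma \<kappa>_mult:
  assumes "g \<in> carrier G" "g' \<in> carrier G" "X \<in> carrier (G Mod H)"
  shows "\<kappa> (g \<otimes>\<^bsub>G\<^esub> g') X = \<kappa> g (g' \<rhd> X) \<otimes>\<^bsub>G\<^esub> \<kappa> g' X"
proof -
  have cancel: "x \<otimes>\<^bsub>G\<^esub> (inv\<^bsub>G\<^esub> x \<otimes>\<^bsub>G\<^esub> y) = y" if "x \<in> carrier G" "y \<in> carrier G" for x y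
    using that by (simp add: G.m_assoc[symmetric])
  have "\<sigma> (g \<rhd> g' \<rhd> X) \<in> carrier G" "\<sigma> X \<in> carrier G" "\<sigma> (g' \<rhd> X) \<in> carrier G"
    using assms section_closed(1) translate_closed by blast+
  then show ?thesis using assms by (simp add: \<kappa>_def translate_mult G.m_assoc cancel)
qed

lemma \<kappa>_surj:
  assumes h: "h \<in> H \<inter> GA.Gm j" and X: "X \<in> carrier (G Mod H)"
  obtains g where "g \<in> GA.Gm j" "g \<rhd> X = X" "\<kappa> g X = h"
proof
  interpret Hj: normal "H \<inter> GA.Gm j" G using H_chain_normal by simp
  let ?g = "\<sigma> X \<otimes>\<^bsub>G\<^esub> h \<otimes>\<^bsub>G\<^esub> inv\<^bsub>G\<^esub> \<sigma> X"
  note s = section_closed(1)[OF X]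
  have g: "?g \<in> H \<inter> GA.Gm j" using Hj.inv_op_closed2 s h by blast
  then show "?g \<in> GA.Gm j" by blast
  show gX: "?g \<rhd> X = X" using g X translate_H by blast
  have "h \<in> carrier G" using h by (rule Hj.mem_carrier)
  then show "\<kappa> ?g X = h" using s unfolding \<kappa>_def gX by (simp add: G.m_assoc G.inv_solve_left')
qed

end

section \<open>The action on the induced module\<close>

lemma induced_module_simps [simp]:
  "carrier (induced_module K G H N) = carrier (G Mod H) \<rightarrow>\<^sub>E carrier N"
  "zero (induced_module K G H N) = (\<lambda>X\<in>carrier (G Mod H). \<zero>\<^bsub>N\<^esub>)"
  "add (induced_module K G H N) = (\<lambda>u v. \<lambda>X\<in>carrier (G Mod H). u X \<oplus>\<^bsub>N\<^esub> v X)"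
  "smult (induced_module K G H N) = (\<lambda>a u. \<lambda>X\<in>carrier (G Mod H).
       ga_monom K (G\<lparr>carrier := H\<rparr>) (a \<one>\<^bsub>G\<^esub>) \<one>\<^bsub>G\<^esub> \<odot>\<^bsub>N\<^esub> u X)"
  by (simp_all add: induced_module_def)

lemma induced_fragment_simps [simp]:
  "carrier (induced_fragment K G H Gs d T N) = carrier (G Mod H) \<rightarrow>\<^sub>E carrier N"
  "zero (induced_fragment K G H Gs d T N) = (\<lambda>X\<in>carrier (G Mod H). \<zero>\<^bsub>N\<^esub>)"
  "add (induced_fragment K G H Gs d T N) = (\<lambda>u v. \<lambda>X\<in>carrier (G Mod H). u X \<oplus>\<^bsub>N\<^esub> v X)"
  "smult (induced_fragment K G H Gs d T N) = (\<lambda>a u. \<lambda>X\<in>carrier (G Mod H).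
       ga_monom K (G\<lparr>carrier := H\<rparr>) (a \<one>\<^bsub>G\<^esub>) \<one>\<^bsub>G\<^esub> \<odot>\<^bsub>N\<^esub> u X)"
  "level (induced_fragment K G H Gs d T N) = (\<lambda>j. carrier (G Mod H) \<rightarrow>\<^sub>E level N j)"
  "star (induced_fragment K G H Gs d T N) = (\<lambda>j. carrier (G Mod H) \<rightarrow>\<^sub>E star N j)"
  "act (induced_fragment K G H Gs d T N) = induced_act K G H Gs d T N"
  by (simp_all add: induced_fragment_def induced_module_def module.defs fragment.defs)

locale fragment_induction = induction_datum K G H Gs T d +
    NF: fragment "group_algebra K (G\<lparr>carrier := H\<rparr>)"
      "ga_filtration K (G\<lparr>carrier := H\<rparr>) (\<lambda>i. H \<inter> Gs i) d" N
  for K :: "('k, 'c) ring_scheme"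
    and G :: "('a, 'b) monoid_scheme"
    and H :: "'a set"
    and Gs T :: "nat \<Rightarrow> 'a set"
    and d :: nat
    and N :: "('a \<Rightarrow> 'k, 'm) fragment"
begin

section \<open>Scalars, levels and stars of N\<close>

abbreviation scal where "scal c x \<equiv> HA.monom c \<one>\<^bsub>G\<^esub> \<odot>\<^bsub>N\<^esub> x"

lemma one_in_Gm: "\<one>\<^bsub>G\<^esub> \<in> GA.Gm j" "\<one>\<^bsub>G\<^esub> \<in> HA.Gm j"
  using subgroup.one_closed[OF GA.Gm_subgroup] H.one_closed by auto

lemma level_star: "x \<in> level N i \<Longrightarrow> x \<in> star N i"
  using NF.f1_level by blast

lemma star_subgroup: "subgroup (star N i) (add_monoid N)"
  using NF.f1_submodule by (simp add: submodule_def)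

lemma star_carrier: "x \<in> star N i \<Longrightarrow> x \<in> carrier N"
  using subgroup.mem_carrier[OF star_subgroup] by simp

lemma level_carrier: "x \<in> level N i \<Longrightarrow> x \<in> carrier N"
  using star_carrier level_star by blast

lemma level_mono: "i \<le> j \<Longrightarrow> level N j \<subseteq> level N i"
  by (induction j rule: dec_induct) (use NF.level_antimono in blast)+

lemma star_0: "star N 0 = carrier N"
  using NF.f1_level[of 0] star_carrier NF.level_0 by auto

lemma scalar_in_filtration: "c \<in> carrier K \<Longrightarrow> HA.monom c \<one>\<^bsub>G\<^esub> \<in> HA.F i"
  using HA.monom_in_filtration[OF _ one_in_Gm(2)] .

lemma scal_closed: "\<lbrakk>c \<in> carrier K; x \<in> carrier N\<rbrakk> \<Longrightarrow> scal c x \<in> carrier N"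
  using NF.S.lm_closed scalar_in_filtration by simp

lemma scal_add_left: "\<lbrakk>c \<in> carrier K; c' \<in> carrier K; x \<in> carrier N\<rbrakk> \<Longrightarrow>
    scal (c \<oplus>\<^bsub>K\<^esub> c') x = scal c x \<oplus>\<^bsub>N\<^esub> scal c' x"
  using NF.S.lm_l_distr scalar_in_filtration HA.monom_add by simp

lemma scal_add_right: "\<lbrakk>c \<in> carrier K; x \<in> carrier N; y \<in> carrier N\<rbrakk> \<Longrightarrow>
    scal c (x \<oplus>\<^bsub>N\<^esub> y) = scal c x \<oplus>\<^bsub>N\<^esub> scal c y"
  using NF.S.lm_r_distr scalar_in_filtration by simp

lemma scal_mult: "\<lbrakk>c \<in> carrier K; c' \<in> carrier K; x \<in> carrier N\<rbrakk> \<Longrightarrow>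
    scal (c \<otimes>\<^bsub>K\<^esub> c') x = scal c (scal c' x)"
  using NF.S.lm_assoc[of "HA.monom c \<one>\<^bsub>G\<^esub>" "HA.monom c' \<one>\<^bsub>G\<^esub>" x] scalar_in_filtration
    HA.monom_mult[of c c' "\<one>\<^bsub>G\<^esub>" "\<one>\<^bsub>G\<^esub>"] by simp

lemma scal_one: "x \<in> carrier N \<Longrightarrow> scal \<one>\<^bsub>K\<^esub> x = x"
  using NF.S.lm_one HA.monom_one by simp

lemma scal_zero_left: "x \<in> carrier N \<Longrightarrow> scal \<zero>\<^bsub>K\<^esub> x = \<zero>\<^bsub>N\<^esub>"
  using scal_add_left[of "\<zero>\<^bsub>K\<^esub>" "\<zero>\<^bsub>K\<^esub>" x] scal_closed[of "\<zero>\<^bsub>K\<^esub>" x]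
  by (metis K.zero_closed K.l_zero NF.S.M.add.r_cancel_one)

lemma scal_zero_right: "c \<in> carrier K \<Longrightarrow> scal c \<zero>\<^bsub>N\<^esub> = \<zero>\<^bsub>N\<^esub>"
  using scal_add_right[of c "\<zero>\<^bsub>N\<^esub>" "\<zero>\<^bsub>N\<^esub>"] scal_closed[of c "\<zero>\<^bsub>N\<^esub>"]
  by (metis NF.S.M.zero_closed NF.S.M.l_zero NF.S.M.add.r_cancel_one)

lemma scal_act_0: "\<lbrakk>c \<in> carrier K; x \<in> carrier N\<rbrakk> \<Longrightarrow>
    scal c x = act N 0 (HA.monom c \<one>\<^bsub>G\<^esub>) x"
  using NF.f1_scalar scalar_in_filtration by simp

lemma scal_star: "\<lbrakk>c \<in> carrier K; x \<in> star N i\<rbrakk> \<Longrightarrow> scal c x \<in> star N i"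
  using submodule.smult_closed[OF NF.f1_submodule] scalar_in_filtration by simp

lemma scal_level: "\<lbrakk>c \<in> carrier K; x \<in> level N i\<rbrakk> \<Longrightarrow> scal c x \<in> level N i"
  using NF.f2_level[of 0 i] scalar_in_filtration scal_act_0 level_carrier by simp

text \<open>The coefficient acts last and through F_0, mirroring \<open>induced_act\<close>. This
  form makes sense and is additive in \<open>c\<close> on the whole of \<open>star N j\<close>; its
  identification with phi_j applied to the monomial c k comes from (f3) and is made on
  \<open>level N j\<close>.\<close>

definition scaled_act where "scaled_act j c k x = scal c (act N j (HA.monom \<one>\<^bsub>K\<^esub> k) x)"

lemma unit_in_filtration: "k \<in> HA.Gm j \<Longrightarrow> HA.monom \<one>\<^bsub>K\<^esub> k \<in> HA.F j"
  by (rule HA.monom_in_filtration[OF K.one_closed])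

lemma scaled_act_closed: "\<lbrakk>c \<in> carrier K; k \<in> HA.Gm j; x \<in> star N j\<rbrakk> \<Longrightarrow> scaled_act j c k x \<in> carrier N"
  unfolding scaled_act_def by (intro scal_closed NF.f1_closed unit_in_filtration)

lemma scaled_act_add_coeff: "\<lbrakk>c \<in> carrier K; c' \<in> carrier K; k \<in> HA.Gm j; x \<in> star N j\<rbrakk> \<Longrightarrow>
    scaled_act j (c \<oplus>\<^bsub>K\<^esub> c') k x = scaled_act j c k x \<oplus>\<^bsub>N\<^esub> scaled_act j c' k x"
  unfolding scaled_act_def by (intro scal_add_left NF.f1_closed unit_in_filtration)

lemma scaled_act_zero_coeff: "\<lbrakk>k \<in> HA.Gm j; x \<in> star N j\<rbrakk> \<Longrightarrow> scaled_act j \<zero>\<^bsub>K\<^esub> k x = \<zero>\<^bsub>N\<^esub>"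
  unfolding scaled_act_def by (intro scal_zero_left NF.f1_closed unit_in_filtration)

lemma scaled_act_add_arg: "\<lbrakk>c \<in> carrier K; k \<in> HA.Gm j; x \<in> star N j; y \<in> star N j\<rbrakk> \<Longrightarrow>
    scaled_act j c k (x \<oplus>\<^bsub>N\<^esub> y) = scaled_act j c k x \<oplus>\<^bsub>N\<^esub> scaled_act j c k y"
  unfolding scaled_act_def NF.f1_add_right[OF unit_in_filtration]
  by (intro scal_add_right NF.f1_closed unit_in_filtration)

lemma scaled_act_one: "\<lbrakk>c \<in> carrier K; x \<in> star N j\<rbrakk> \<Longrightarrow> scaled_act j c \<one>\<^bsub>G\<^esub> x = scal c x"
  unfolding scaled_act_def using HA.monom_one NF.f1_one by simp

lemma scaled_act_level: "\<lbrakk>c \<in> carrier K; k \<in> HA.Gm j; j \<le> i; x \<in> level N i\<rbrakk> \<Longrightarrow> scaled_act j c k x \<in> level N (i - j)"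
  unfolding scaled_act_def by (intro scal_level NF.f2_level unit_in_filtration)

lemma scaled_act_coincide: "\<lbrakk>k \<in> HA.Gm j; j \<le> i; x \<in> level N i\<rbrakk> \<Longrightarrow> scaled_act i c k x = scaled_act j c k x"
  unfolding scaled_act_def using NF.f2_coincide[OF _ unit_in_filtration] by simp

text \<open>This is (f3) at the indices 0, j and \<mu> = j, whose condition is F_0 F_j \<subseteq>
  F_j.\<close>

lemma scaled_act_act:
  assumes "c \<in> carrier K" "k \<in> HA.Gm j" "x \<in> level N j"
  shows "scaled_act j c k x = act N j (HA.monom c k) x"
proof -
  have kH: "k \<in> carrier (G\<lparr>carrier := H\<rparr>)" using assms(2) by simp
  have "scaled_act j c k x = act N 0 (HA.monom c \<one>\<^bsub>G\<^esub>) (act N j (HA.monom \<one>\<^bsub>K\<^esub> k) x)"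
    unfolding scaled_act_def using assms
    by (intro scal_act_0 NF.f1_closed unit_in_filtration level_star)
  also have "\<dots> = act N j (HA.monom c \<one>\<^bsub>G\<^esub> \<otimes>\<^bsub>HA.A\<^esub> HA.monom \<one>\<^bsub>K\<^esub> k) x"
    using assms by (intro NF.f3_assoc scalar_in_filtration unit_in_filtration)
      (auto dest: NF.filt_mult)
  also have "HA.monom c \<one>\<^bsub>G\<^esub> \<otimes>\<^bsub>HA.A\<^esub> HA.monom \<one>\<^bsub>K\<^esub> k = HA.monom c k"
    using HA.monom_mult[OF assms(1) K.one_closed _ kH, of "\<one>\<^bsub>G\<^esub>"] assms(1) kH H.subset by auto
  finally show ?thesis .
qed

context
  fixes i j \<mu> :: nat
  assumes le: "j \<le> \<mu>" and sub: "HA.Gm i \<subseteq> HA.Gm \<mu>" "HA.Gm j \<subseteq> HA.Gm \<mu>"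
begin

text \<open>The inclusions fixed in this context are the group form of the condition in (f3);
  \<open>filtration_mult_closed\<close> turns them back into an inclusion of products in KH.\<close>

lemma scaled_act_star:
  assumes "c \<in> carrier K" "k \<in> HA.Gm j" "x \<in> level N \<mu>"
  shows "scaled_act j c k x \<in> star N i"
proof -
  have "act N j (HA.monom \<one>\<^bsub>K\<^esub> k) x \<in> star N i"
    using NF.f3_level[of i j \<mu>, OF HA.filtration_mult_closed[OF _ _ sub] le unit_in_filtration]
      assms by blast
  then show ?thesis unfolding scaled_act_def using assms(1) scal_star by blast
qed

text \<open>The scalar \<open>c'\<close> stands between the two group elements and cannot simply be
  moved past phi_i on a star. It is absorbed into the monomial c' k' on level j, carried through one
  application of (f3), and extracted again on level \<mu>.\<close>

lemma scaled_act_assoc: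
  assumes "c \<in> carrier K" "c' \<in> carrier K" "k \<in> HA.Gm i" "k' \<in> HA.Gm j" "x \<in> level N \<mu>"
  shows "scaled_act i c k (scaled_act j c' k' x) = scaled_act \<mu> (c \<otimes>\<^bsub>K\<^esub> c') (k \<otimes>\<^bsub>G\<^esub> k') x"
proof -
  have xj: "x \<in> level N j" using assms(5) level_mono[OF le] by blast
  have kk: "k \<otimes>\<^bsub>G\<^esub> k' \<in> HA.Gm \<mu>"
    using assms(3,4) sub subgroup.m_closed[OF HA.Gm_subgroup[of \<mu>]] by simp blast
  have "scaled_act i c k (scaled_act j c' k' x) = scal c (act N i (HA.monom \<one>\<^bsub>K\<^esub> k) (act N j (HA.monom c' k') x))"
    using scaled_act_act[OF assms(2,4) xj] by (simp add: scaled_act_def)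
  also have "act N i (HA.monom \<one>\<^bsub>K\<^esub> k) (act N j (HA.monom c' k') x)
      = act N \<mu> (HA.monom \<one>\<^bsub>K\<^esub> k \<otimes>\<^bsub>HA.A\<^esub> HA.monom c' k') x"
    using assms HA.filtration_mult_closed[OF _ _ sub] le
    by (intro NF.f3_assoc unit_in_filtration HA.monom_in_filtration)
  also have "\<dots> = act N \<mu> (HA.monom c' (k \<otimes>\<^bsub>G\<^esub> k')) x"
    using HA.monom_mult[of "\<one>\<^bsub>K\<^esub>" c' k k'] assms by simp
  also have "\<dots> = scaled_act \<mu> c' (k \<otimes>\<^bsub>G\<^esub> k') x" using scaled_act_act[OF assms(2) kk assms(5)] by simp
  also have "scal c \<dots> = scaled_act \<mu> (c \<otimes>\<^bsub>K\<^esub> c') (k \<otimes>\<^bsub>G\<^esub> k') x"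
    unfolding scaled_act_def using assms kk
    by (subst scal_mult) (auto intro!: NF.f1_closed unit_in_filtration level_star)
  finally show ?thesis .
qed

end

section \<open>Coordinates of the induced action\<close>

abbreviation P where "P \<equiv> induced_module K G H N"
abbreviation M where "M \<equiv> induced_fragment K G H Gs d T N"
abbreviation Q where "Q \<equiv> carrier (G Mod H)"

lemma Q_finite: "finite Q"
  using finite by (simp add: carrier_FactGroup)

lemma abelian_P: "abelian_group P" and abelian_M: "abelian_group M"
  by (rule PiE_abelian_group[OF NF.S.M.abelian_group_axioms]; simp)+

sublocale PM: abelian_group P by (rule abelian_P)

lemma \<kappa>_in_H: "\<lbrakk>g \<in> GA.Gm j; X \<in> Q\<rbrakk> \<Longrightarrow> \<kappa> g X \<in> HA.Gm j"
  by (rule \<kappa>_closed)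

lemma basic_act_eq:
  assumes "g \<in> carrier G" "X \<in> Q"
  shows "induced_basic_act K G H (T d) N j g X x =
    pure_tensor G H N (g \<rhd> X) (act N j (HA.monom \<one>\<^bsub>K\<^esub> (\<kappa> g X)) x)"
  using \<kappa>_eq_cocycle[OF assms] by (simp add: induced_basic_act_def Let_def)

text \<open>This is what g contributes to the coordinate Y of a u: the only coset that g moves to Y
  is g^-1 Y.\<close>

abbreviation act_term where
  "act_term j a u Y g \<equiv> scaled_act j (a g) (\<kappa> g (inv\<^bsub>G\<^esub> g \<rhd> Y)) (u (inv\<^bsub>G\<^esub> g \<rhd> Y))"

lemma act_term_closed:
  assumes "a \<in> carrier GA.A" "u \<in> Q \<rightarrow>\<^sub>E star N j" "Y \<in> Q" "g \<in> GA.Gm j"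
  shows "act_term j a u Y g \<in> carrier N"
proof -
  have g: "g \<in> carrier G" using assms(4) GA.Gm_subset by blast
  then have X: "inv\<^bsub>G\<^esub> g \<rhd> Y \<in> Q" using translate_closed assms(3) by simp
  show ?thesis
    using assms g X by (intro scaled_act_closed \<kappa>_in_H PiE_mem[OF assms(2)]) auto
qed

text \<open>The action is defined by a double sum of functions. Evaluated at Y, the inner sum over
  cosets keeps only X = g^-1 Y, because g permutes the cosets. What remains is a single sum in
  \<open>N\<close>, the form in which the axioms are checked.\<close>

lemma induced_act_closed_apply:
  assumes a: "a \<in> carrier GA.A" and u: "u \<in> Q \<rightarrow>\<^sub>E star N j"
  shows "induced_act K G H Gs d T N j a u \<in> carrier P"
    and "Y \<in> Q \<Longrightarrow> induced_act K G H Gs d T N j a u Y = (\<Oplus>\<^bsub>N\<^esub>g\<in>GA.Gm j. act_term j a u Y g)"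
proof -
  define t where "t g X = ga_monom K G (a g) \<one>\<^bsub>G\<^esub> \<odot>\<^bsub>P\<^esub> induced_basic_act K G H (T d) N j g X (u X)" for g X
  have Gm_fin: "finite (GA.Gm j)" using GA.Gm_subset finite finite_subset by blast
  have act_cl: "act N j (HA.monom \<one>\<^bsub>K\<^esub> (\<kappa> g X)) (u X) \<in> carrier N" if "g \<in> GA.Gm j" "X \<in> Q" for g X
    using that u by (intro NF.f1_closed unit_in_filtration \<kappa>_in_H) auto
  have t_apply: "t g X Y = (if Y = g \<rhd> X then scaled_act j (a g) (\<kappa> g X) (u X) else \<zero>\<^bsub>N\<^esub>)"
    if "g \<in> GA.Gm j" "X \<in> Q" "Y \<in> Q" for g X Y
  proof -
    have g: "g \<in> carrier G" using that GA.Gm_subset by blast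
    show ?thesis
      using that g GA.coeff_closed[OF a g]
      by (simp add: t_def basic_act_eq pure_tensor_def GA.monom_apply scaled_act_def scal_zero_right)
  qed
  have scaled_act_cl: "scaled_act j (a g) (\<kappa> g X) (u X) \<in> carrier N" if "g \<in> GA.Gm j" "X \<in> Q" for g X
    using that u GA.coeff_closed[OF a] GA.Gm_subset by (intro scaled_act_closed \<kappa>_in_H) auto
  have t_cl: "t g X \<in> carrier P" if "g \<in> GA.Gm j" "X \<in> Q" for g X
  proof -
    have "t g X Y \<in> carrier N" if "Y \<in> Q" for Y
      using t_apply[of g X Y] scaled_act_cl \<open>g \<in> GA.Gm j\<close> \<open>X \<in> Q\<close> that by simp
    moreover have "t g X \<in> extensional Q" unfolding t_def by simp
    ultimately show ?thesis by (simp add: PiE_def)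
  qed
  have inner_cl: "(\<Oplus>\<^bsub>P\<^esub>X\<in>Q. t g X) \<in> carrier P" if "g \<in> GA.Gm j" for g
    using t_cl that by (intro PM.finsum_closed Pi_I)
  have act: "induced_act K G H Gs d T N j a u = (\<Oplus>\<^bsub>P\<^esub>g\<in>GA.Gm j. \<Oplus>\<^bsub>P\<^esub>X\<in>Q. t g X)"
    unfolding induced_act_def t_def ..
  show "induced_act K G H Gs d T N j a u \<in> carrier P"
    unfolding act by (rule PM.finsum_closed[OF Pi_I[OF inner_cl]])
  assume Y: "Y \<in> Q"
  have "induced_act K G H Gs d T N j a u Y = (\<Oplus>\<^bsub>N\<^esub>g\<in>GA.Gm j. (\<Oplus>\<^bsub>P\<^esub>X\<in>Q. t g X) Y)"
    unfolding act
    by (rule PiE_finsum_apply[OF NF.S.M.abelian_group_axioms, where I = Q])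
      (use Gm_fin Y inner_cl in simp_all)
  also have "\<dots> = (\<Oplus>\<^bsub>N\<^esub>g\<in>GA.Gm j. act_term j a u Y g)"
  proof (rule NF.S.M.finsum_cong_closed)
    fix g assume gj: "g \<in> GA.Gm j"
    then have g: "g \<in> carrier G" using GA.Gm_subset by blast
    have eq: "Y = g \<rhd> X \<longleftrightarrow> inv\<^bsub>G\<^esub> g \<rhd> Y = X" if "X \<in> Q" for X
      using g Y that translate_inv by metis
    have "(\<Oplus>\<^bsub>P\<^esub>X\<in>Q. t g X) Y = (\<Oplus>\<^bsub>N\<^esub>X\<in>Q. t g X Y)"
      using Q_finite Y t_cl gj
      by (intro PiE_finsum_apply[OF NF.S.M.abelian_group_axioms]) auto
    also have "\<dots> = (\<Oplus>\<^bsub>N\<^esub>X\<in>Q. if inv\<^bsub>G\<^esub> g \<rhd> Y = X then scaled_act j (a g) (\<kappa> g X) (u X) else \<zero>\<^bsub>N\<^esub>)"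
      using scaled_act_cl gj Y by (intro NF.S.M.finsum_cong_closed) (auto simp: t_apply eq)
    also have "\<dots> = act_term j a u Y g"
      using scaled_act_cl gj g Y Q_finite by (intro NF.S.M.finsum_singleton translate_closed) auto
    finally show "(\<Oplus>\<^bsub>P\<^esub>X\<in>Q. t g X) Y = act_term j a u Y g" .
    show "act_term j a u Y g \<in> carrier N" using a u Y gj by (rule act_term_closed)
  qed
  finally show "induced_act K G H Gs d T N j a u Y = (\<Oplus>\<^bsub>N\<^esub>g\<in>GA.Gm j. act_term j a u Y g)" .
qed

text \<open>All membership claims of (f2) and (f3) have this shape, with \<open>L\<close> a level or
  a star of \<open>N\<close>; being a subgroup, it absorbs the sum over g.\<close>

lemma induced_act_in_subgroup:
  assumes "a \<in> carrier GA.A" "u \<in> Q \<rightarrow>\<^sub>E star N j" "subgroup L (add_monoid N)"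
    and "\<And>g X. \<lbrakk>g \<in> GA.Gm j; X \<in> Q\<rbrakk> \<Longrightarrow> scaled_act j (a g) (\<kappa> g X) (u X) \<in> L"
  shows "induced_act K G H Gs d T N j a u \<in> Q \<rightarrow>\<^sub>E L"
proof -
  have "induced_act K G H Gs d T N j a u Y \<in> L" if "Y \<in> Q" for Y
    unfolding induced_act_closed_apply(2)[OF assms(1,2) that]
    using that GA.Gm_subset by (intro NF.S.M.finsum_in_subgroup assms translate_closed) auto
  then show ?thesis using induced_act_closed_apply(1)[OF assms(1,2)] by (auto simp: PiE_def)
qed

abbreviation iact where "iact \<equiv> induced_act K G H Gs d T N"

lemma level_star_PiE: "u \<in> Q \<rightarrow>\<^sub>E level N i \<Longrightarrow> j \<le> i \<Longrightarrow> u \<in> Q \<rightarrow>\<^sub>E star N j"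
  using PiE_mono[of Q "\<lambda>_. level N i" "\<lambda>_. star N j"] level_mono[of j i] NF.f1_level[of j] by blast

lemma translate_inv_closed: "\<lbrakk>g \<in> GA.Gm j; X \<in> Q\<rbrakk> \<Longrightarrow> inv\<^bsub>G\<^esub> g \<rhd> X \<in> Q"
  using GA.Gm_subset[of j] by (intro translate_closed) auto

lemma Gm_finite: "finite (GA.Gm j)"
  using GA.Gm_subset finite finite_subset by blast

lemma carrier_P_eqI:
  assumes "u \<in> carrier P" "v \<in> carrier P" "\<And>Y. Y \<in> Q \<Longrightarrow> u Y = v Y"
  shows "u = v"
  using assms by (auto intro: PiE_ext)

lemma induced_act_monom:
  assumes "c \<in> carrier K" "g \<in> GA.Gm j" "u \<in> Q \<rightarrow>\<^sub>E star N j" "Y \<in> Q"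
  shows "iact j (GA.monom c g) u Y = scaled_act j c (\<kappa> g (inv\<^bsub>G\<^esub> g \<rhd> Y)) (u (inv\<^bsub>G\<^esub> g \<rhd> Y))"
proof -
  have a: "GA.monom c g \<in> carrier GA.A" using assms(1) by (rule GA.monom_closed)
  have sub: "x \<in> carrier G" if "x \<in> GA.Gm j" for x using that GA.Gm_subset by blast
  note t = act_term_closed[OF a assms(3,4)]
  have "iact j (GA.monom c g) u Y = (\<Oplus>\<^bsub>N\<^esub>x\<in>GA.Gm j. act_term j (GA.monom c g) u Y x)"
    by (rule induced_act_closed_apply(2)[OF a assms(3,4)])
  also have "\<dots> = (\<Oplus>\<^bsub>N\<^esub>x\<in>{g}. act_term j (GA.monom c g) u Y x)"
  proof (rule NF.S.M.finsum_subset_eq[symmetric, OF Gm_finite])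
    fix x assume "x \<in> GA.Gm j - {g}"
    then show "act_term j (GA.monom c g) u Y x = \<zero>\<^bsub>N\<^esub>"
      using sub assms translate_inv_closed by (auto simp: GA.monom_apply intro!: scaled_act_zero_coeff \<kappa>_in_H)
  qed (use assms(2) t in auto)
  also have "\<dots> = act_term j (GA.monom c g) u Y g" using t[OF assms(2)] by simp
  finally show ?thesis using GA.monom_apply[OF sub[OF assms(2)]] by simp
qed

lemma filtration_monom_0: "a \<in> GA.F 0 \<Longrightarrow> a = GA.monom (a \<one>\<^bsub>G\<^esub>) \<one>\<^bsub>G\<^esub>"
  using chain by (intro ext) (auto simp: GA.filtration_iff ga_monom_def normal_chain_def PiE_arb[of a])

lemma filtration_coeff: "\<lbrakk>a \<in> GA.F i; g \<in> carrier G\<rbrakk> \<Longrightarrow> a g \<in> carrier K"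
  using GA.filtration_carrier GA.coeff_closed by blast

lemma induced_left_module: "left_module (GA.A\<lparr>carrier := GA.F 0\<rparr>) M"
proof (intro left_module.intro left_module_axioms.intro abelian_M
    positive_filtration.filtration_0_ring[OF GA.positive_filtration])
  note c = filtration_coeff[OF _ G.one_closed]
  fix a b u v
  assume a: "a \<in> carrier (GA.A\<lparr>carrier := GA.F 0\<rparr>)" and u: "u \<in> carrier M"
  then have a': "a \<one>\<^bsub>G\<^esub> \<in> carrier K" and u': "\<And>X. X \<in> Q \<Longrightarrow> u X \<in> carrier N" using c by auto
  show "a \<odot>\<^bsub>M\<^esub> u \<in> carrier M" using a' u' scal_closed by simp
  show "a \<odot>\<^bsub>M\<^esub> (u \<oplus>\<^bsub>M\<^esub> v) = a \<odot>\<^bsub>M\<^esub> u \<oplus>\<^bsub>M\<^esub> a \<odot>\<^bsub>M\<^esub> v" if "v \<in> carrier M"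
    using a' u' that by (auto intro!: restrict_ext scal_add_right)
  assume b: "b \<in> carrier (GA.A\<lparr>carrier := GA.F 0\<rparr>)"
  then have b': "b \<one>\<^bsub>G\<^esub> \<in> carrier K" using c by simp
  show "(a \<oplus>\<^bsub>GA.A\<lparr>carrier := GA.F 0\<rparr>\<^esub> b) \<odot>\<^bsub>M\<^esub> u = a \<odot>\<^bsub>M\<^esub> u \<oplus>\<^bsub>M\<^esub> b \<odot>\<^bsub>M\<^esub> u"
    using a' b' u' by (auto intro!: restrict_ext scal_add_left)
  \<comment> \<open>The scalar multiplication reads only the coefficient at 1. As G_0 is trivial,
    elements of F_0 are multiples of 1, so this coefficient is multiplicative on F_0.\<close>
  have "a \<otimes>\<^bsub>GA.A\<^esub> b = GA.monom (a \<one>\<^bsub>G\<^esub> \<otimes>\<^bsub>K\<^esub> b \<one>\<^bsub>G\<^esub>) (\<one>\<^bsub>G\<^esub> \<otimes>\<^bsub>G\<^esub> \<one>\<^bsub>G\<^esub>)"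
    using a b a' b' filtration_monom_0 GA.monom_mult[OF a' b' G.one_closed G.one_closed] by simp
  then have "(a \<otimes>\<^bsub>GA.A\<^esub> b) \<one>\<^bsub>G\<^esub> = a \<one>\<^bsub>G\<^esub> \<otimes>\<^bsub>K\<^esub> b \<one>\<^bsub>G\<^esub>" by (simp add: GA.monom_apply)
  then show "(a \<otimes>\<^bsub>GA.A\<lparr>carrier := GA.F 0\<rparr>\<^esub> b) \<odot>\<^bsub>M\<^esub> u = a \<odot>\<^bsub>M\<^esub> (b \<odot>\<^bsub>M\<^esub> u)"
    using a' b' u' by (auto intro!: restrict_ext scal_mult)
next
  fix u assume "u \<in> carrier M"
  then show "\<one>\<^bsub>GA.A\<lparr>carrier := GA.F 0\<rparr>\<^esub> \<odot>\<^bsub>M\<^esub> u = u"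
    using scal_one by (intro ext) (auto simp: PiE_arb[of u])
qed

text \<open>The inclusion is tested on products of group elements with coefficient 1, which is
  non-zero in a field. Taking one of the two factors to be the identity of G yields each
  inclusion.\<close>

lemma filtration_product_chain:
  assumes "\<And>a b. \<lbrakk>a \<in> GA.F i; b \<in> GA.F j\<rbrakk> \<Longrightarrow> a \<otimes>\<^bsub>GA.A\<^esub> b \<in> GA.F \<mu>"
  shows "GA.Gm i \<subseteq> GA.Gm \<mu>" "GA.Gm j \<subseteq> GA.Gm \<mu>"
proof -
  have *: "g \<otimes>\<^bsub>G\<^esub> g' \<in> GA.Gm \<mu>" if g: "g \<in> GA.Gm i" "g' \<in> GA.Gm j" for g g'
  proof (rule ccontr)
    assume "g \<otimes>\<^bsub>G\<^esub> g' \<notin> GA.Gm \<mu>"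
    moreover have gG: "g \<in> carrier G" "g' \<in> carrier G" using g GA.Gm_subset by blast+
    then have "g \<otimes>\<^bsub>G\<^esub> g' \<in> carrier G" by simp
    moreover have "GA.monom \<one>\<^bsub>K\<^esub> (g \<otimes>\<^bsub>G\<^esub> g') \<in> GA.F \<mu>"
      using assms[OF GA.monom_in_filtration GA.monom_in_filtration] g gG
        GA.monom_mult[of "\<one>\<^bsub>K\<^esub>" "\<one>\<^bsub>K\<^esub>" g g'] by force
    ultimately have "GA.monom \<one>\<^bsub>K\<^esub> (g \<otimes>\<^bsub>G\<^esub> g') (g \<otimes>\<^bsub>G\<^esub> g') = \<zero>\<^bsub>K\<^esub>"
      unfolding GA.filtration_iff by blast
    then have "\<one>\<^bsub>K\<^esub> = \<zero>\<^bsub>K\<^esub>" using gG by (simp add: GA.monom_apply)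
    then show False by simp
  qed
  show "GA.Gm i \<subseteq> GA.Gm \<mu>"
    using *[OF _ one_in_Gm(1)] GA.Gm_subset[of i] by (auto simp: subset_iff)
  show "GA.Gm j \<subseteq> GA.Gm \<mu>"
    using *[OF one_in_Gm(1)] GA.Gm_subset[of j] by (auto simp: subset_iff)
qed

section \<open>The fragment axioms for the induced action\<close>

lemma induced_act_closed:
  assumes "a \<in> GA.F i" "u \<in> Q \<rightarrow>\<^sub>E star N i"
  shows "iact i a u \<in> Q \<rightarrow>\<^sub>E carrier N"
  using induced_act_closed_apply(1)[OF GA.filtration_carrier] assms by simp

lemma induced_act_level:
  assumes "j \<le> i" "a \<in> GA.F j" "u \<in> Q \<rightarrow>\<^sub>E level N i"
  shows "iact j a u \<in> Q \<rightarrow>\<^sub>E level N (i - j)"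
proof (rule induced_act_in_subgroup[OF GA.filtration_carrier[OF assms(2)]
      level_star_PiE[OF assms(3,1)] NF.level_subgroup])
  fix g X assume "g \<in> GA.Gm j" "X \<in> Q"
  then show "scaled_act j (a g) (\<kappa> g X) (u X) \<in> level N (i - j)"
    using assms filtration_coeff[OF assms(2)] GA.Gm_subset[of j] by (intro scaled_act_level \<kappa>_in_H) auto
qed

text \<open>The index enters twice: as the range of summation and as the choice of the operation in
  \<open>N\<close>. The extra summands for g in G_i outside G_j vanish because a is supported on
  G_j; the remaining ones agree by (f2) for \<open>N\<close>.\<close>

lemma induced_act_coincide:
  assumes "j \<le> i" "a \<in> GA.F j" "u \<in> Q \<rightarrow>\<^sub>E level N i"
  shows "iact i a u = iact j a u"
proof (rule carrier_P_eqI)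
  note a = GA.filtration_carrier[OF assms(2)]
  note ui = level_star_PiE[OF assms(3) order_refl] and uj = level_star_PiE[OF assms(3,1)]
  show "iact i a u \<in> carrier P" "iact j a u \<in> carrier P"
    by (rule induced_act_closed_apply(1)[OF a], rule ui uj)+
  fix Y assume Y: "Y \<in> Q"
  have "iact i a u Y = (\<Oplus>\<^bsub>N\<^esub>g\<in>GA.Gm i. act_term i a u Y g)"
    by (rule induced_act_closed_apply(2)[OF a ui Y])
  also have "\<dots> = (\<Oplus>\<^bsub>N\<^esub>g\<in>GA.Gm j. act_term i a u Y g)"
  proof (rule NF.S.M.finsum_subset_eq[symmetric, OF Gm_finite])
    show "GA.Gm j \<subseteq> GA.Gm i" using assms(1) by (rule GA.Gm_mono)
    show "act_term i a u Y g \<in> carrier N" if "g \<in> GA.Gm i" for g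
      using act_term_closed[OF a ui Y that] .
    fix g assume g: "g \<in> GA.Gm i - GA.Gm j"
    then have "a g = \<zero>\<^bsub>K\<^esub>" using assms(2) GA.Gm_subset[of i] by (auto simp: GA.filtration_iff)
    then show "act_term i a u Y g = \<zero>\<^bsub>N\<^esub>"
      using g Y translate_inv_closed[of g i Y] PiE_mem[OF ui] by (simp only:) (intro scaled_act_zero_coeff \<kappa>_in_H, auto)
  qed
  also have "\<dots> = (\<Oplus>\<^bsub>N\<^esub>g\<in>GA.Gm j. act_term j a u Y g)"
  proof (rule NF.S.M.finsum_cong_closed)
    fix g assume g: "g \<in> GA.Gm j"
    show "act_term i a u Y g = act_term j a u Y g"
      using assms(1,3) g Y translate_inv_closed[OF g Y] by (intro scaled_act_coincide \<kappa>_in_H) auto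
    show "act_term j a u Y g \<in> carrier N" by (rule act_term_closed[OF a uj Y g])
  qed
  also have "\<dots> = iact j a u Y" by (rule induced_act_closed_apply(2)[OF a uj Y, symmetric])
  finally show "iact i a u Y = iact j a u Y" .
qed

lemma induced_act_star:
  assumes "j \<le> \<mu>" "GA.Gm i \<subseteq> GA.Gm \<mu>" "GA.Gm j \<subseteq> GA.Gm \<mu>"
    and "b \<in> GA.F j" "u \<in> Q \<rightarrow>\<^sub>E level N \<mu>"
  shows "iact j b u \<in> Q \<rightarrow>\<^sub>E star N i"
proof (rule induced_act_in_subgroup[OF GA.filtration_carrier[OF assms(4)]
      level_star_PiE[OF assms(5,1)] star_subgroup])
  have "HA.Gm i \<subseteq> HA.Gm \<mu>" "HA.Gm j \<subseteq> HA.Gm \<mu>" using assms(2,3) by blast+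
  note st = scaled_act_star[OF assms(1) this]
  fix g X assume "g \<in> GA.Gm j" "X \<in> Q"
  then show "scaled_act j (b g) (\<kappa> g X) (u X) \<in> star N i"
    using assms filtration_coeff[OF assms(4)] GA.Gm_subset[of j] by (intro st \<kappa>_in_H) auto
qed

text \<open>At a coordinate Z both sides become sums of terms \<open>W (a g b h) (g h)\<close>: on
  the left over G_i x G_j, on the right by splitting the convolution coefficients of a b over
  G_\<mu>. The supports of a and b make the index sets match.\<close>

lemma induced_act_assoc:
  assumes le: "j \<le> \<mu>" and sub: "GA.Gm i \<subseteq> GA.Gm \<mu>" "GA.Gm j \<subseteq> GA.Gm \<mu>"
    and a: "a \<in> GA.F i" and b: "b \<in> GA.F j" and u: "u \<in> Q \<rightarrow>\<^sub>E level N \<mu>"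
  shows "iact i a (iact j b u) = iact \<mu> (a \<otimes>\<^bsub>GA.A\<^esub> b) u"
proof (rule carrier_P_eqI)
  have Hsub: "HA.Gm i \<subseteq> HA.Gm \<mu>" "HA.Gm j \<subseteq> HA.Gm \<mu>" using sub by blast+
  note aA = GA.filtration_carrier[OF a] and bA = GA.filtration_carrier[OF b]
  note abA = GA.mult_closed[OF aA bA]
  note uj = level_star_PiE[OF u le] and u\<mu> = level_star_PiE[OF u order_refl]
  note bu = induced_act_star[OF le sub b u]
  show "iact i a (iact j b u) \<in> carrier P" by (rule induced_act_closed_apply(1)[OF aA bu])
  show "iact \<mu> (a \<otimes>\<^bsub>GA.A\<^esub> b) u \<in> carrier P" by (rule induced_act_closed_apply(1)[OF abA u\<mu>])
  interpret S: subgroup "GA.Gm \<mu>" G by (rule GA.Gm_subgroup)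
  have aK: "a g \<in> carrier K" and bK: "b g \<in> carrier K" if "g \<in> carrier G" for g
    using that filtration_coeff a b by auto
  fix Z assume Z: "Z \<in> Q"
  \<comment> \<open>\<open>W c l\<close> is the contribution of c l to the coordinate Z, computed
    with phi_\<mu>. Its additivity in \<open>c\<close> is what allows a convolution coefficient to
    be split.\<close>
  define W where "W c l = scaled_act \<mu> c (\<kappa> l (inv\<^bsub>G\<^esub> l \<rhd> Z)) (u (inv\<^bsub>G\<^esub> l \<rhd> Z))" for c l
  have W_side: "\<kappa> l (inv\<^bsub>G\<^esub> l \<rhd> Z) \<in> HA.Gm \<mu>" "u (inv\<^bsub>G\<^esub> l \<rhd> Z) \<in> star N \<mu>" if "l \<in> GA.Gm \<mu>" for l
    using that Z translate_inv_closed[OF that Z] PiE_mem[OF u\<mu>] by (auto intro!: \<kappa>_in_H[of l \<mu>, simplified])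
  have W_closed: "W c l \<in> carrier N" if "c \<in> carrier K" "l \<in> GA.Gm \<mu>" for c l
    unfolding W_def using that W_side by (intro scaled_act_closed)
  have W_add: "W (c \<oplus>\<^bsub>K\<^esub> c') l = W c l \<oplus>\<^bsub>N\<^esub> W c' l"
    if "c \<in> carrier K" "c' \<in> carrier K" "l \<in> GA.Gm \<mu>" for c c' l
    unfolding W_def using that W_side by (intro scaled_act_add_coeff)
  have W_zero: "W \<zero>\<^bsub>K\<^esub> l = \<zero>\<^bsub>N\<^esub>" if "l \<in> GA.Gm \<mu>" for l
    unfolding W_def using that W_side by (intro scaled_act_zero_coeff)

  have term_eq: "act_term i a (iact j b u) Z g = (\<Oplus>\<^bsub>N\<^esub>h\<in>GA.Gm j. W (a g \<otimes>\<^bsub>K\<^esub> b h) (g \<otimes>\<^bsub>G\<^esub> h))"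
    if g: "g \<in> GA.Gm i" for g
  proof -
    have gG: "g \<in> carrier G" using g GA.Gm_subset by blast
    let ?Y = "inv\<^bsub>G\<^esub> g \<rhd> Z"
    have Y: "?Y \<in> Q" by (rule translate_inv_closed[OF g Z])
    have t_star: "act_term j b u ?Y h \<in> star N i" if h: "h \<in> GA.Gm j" for h
      using h Y u bK GA.Gm_subset[of j] translate_inv_closed[OF h Y]
      by (intro scaled_act_star[OF le Hsub] \<kappa>_in_H) auto
    have "act_term i a (iact j b u) Z g = scaled_act i (a g) (\<kappa> g ?Y) (\<Oplus>\<^bsub>N\<^esub>h\<in>GA.Gm j. act_term j b u ?Y h)"
      using induced_act_closed_apply(2)[OF bA uj Y] by simp
    \<comment> \<open>phi_i is additive only on \<open>star N i\<close>, so it matters that each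
      inner summand, and not just their sum, lies there.\<close>
    also have "\<dots> = (\<Oplus>\<^bsub>N\<^esub>h\<in>GA.Gm j. scaled_act i (a g) (\<kappa> g ?Y) (act_term j b u ?Y h))"
      by (rule finsum_additive_on[OF NF.S.M.abelian_group_axioms NF.S.M.abelian_group_axioms
            star_subgroup[of i] scaled_act_closed[OF aK[OF gG] \<kappa>_in_H[OF g Y]]
            scaled_act_add_arg[OF aK[OF gG] \<kappa>_in_H[OF g Y]] Gm_finite t_star])
    also have "\<dots> = (\<Oplus>\<^bsub>N\<^esub>h\<in>GA.Gm j. W (a g \<otimes>\<^bsub>K\<^esub> b h) (g \<otimes>\<^bsub>G\<^esub> h))"
    proof (rule NF.S.M.finsum_cong_closed)
      fix h assume h: "h \<in> GA.Gm j"
      have hG: "h \<in> carrier G" using h GA.Gm_subset by blast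
      let ?X = "inv\<^bsub>G\<^esub> h \<rhd> ?Y"
      have X: "?X \<in> Q" by (rule translate_inv_closed[OF h Y])
      have X_eq: "inv\<^bsub>G\<^esub> (g \<otimes>\<^bsub>G\<^esub> h) \<rhd> Z = ?X"
        using gG hG Z by (simp add: G.inv_mult_group translate_mult)
      have gh: "g \<otimes>\<^bsub>G\<^esub> h \<in> GA.Gm \<mu>" using g h sub by blast
      have "scaled_act i (a g) (\<kappa> g ?Y) (act_term j b u ?Y h)
          = scaled_act \<mu> (a g \<otimes>\<^bsub>K\<^esub> b h) (\<kappa> g ?Y \<otimes>\<^bsub>G\<^esub> \<kappa> h ?X) (u ?X)"
        using aK[OF gG] bK[OF hG] \<kappa>_in_H[OF g Y] \<kappa>_in_H[OF h X] PiE_mem[OF u X]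
        by (rule scaled_act_assoc[OF le Hsub])
      \<comment> \<open>The cocycle identity applies because h moves \<open>?X\<close> back to
        \<open>?Y\<close>.\<close>
      also have "\<kappa> g ?Y \<otimes>\<^bsub>G\<^esub> \<kappa> h ?X = \<kappa> (g \<otimes>\<^bsub>G\<^esub> h) ?X"
        using \<kappa>_mult[OF gG hG X] hG Y by simp
      finally show "scaled_act i (a g) (\<kappa> g ?Y) (act_term j b u ?Y h) = W (a g \<otimes>\<^bsub>K\<^esub> b h) (g \<otimes>\<^bsub>G\<^esub> h)"
        by (simp add: W_def X_eq)
      show "W (a g \<otimes>\<^bsub>K\<^esub> b h) (g \<otimes>\<^bsub>G\<^esub> h) \<in> carrier N"
        using aK[OF gG] bK[OF hG] gh by (intro W_closed) auto
    qed
    finally show ?thesis .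
  qed
  have conv_term: "W ((a \<otimes>\<^bsub>GA.A\<^esub> b) l) l = (\<Oplus>\<^bsub>N\<^esub>g\<in>GA.Gm i. W (a g \<otimes>\<^bsub>K\<^esub> b (inv\<^bsub>G\<^esub> g \<otimes>\<^bsub>G\<^esub> l)) l)"
    if l: "l \<in> GA.Gm \<mu>" for l
  proof -
    have lG: "l \<in> carrier G" using l GA.Gm_subset by blast
    have ab: "a g \<otimes>\<^bsub>K\<^esub> b (inv\<^bsub>G\<^esub> g \<otimes>\<^bsub>G\<^esub> l) \<in> carrier K" if "g \<in> carrier G" for g
      using aK bK that lG by simp
    have "W ((a \<otimes>\<^bsub>GA.A\<^esub> b) l) l = W (\<Oplus>\<^bsub>K\<^esub>g\<in>carrier G. a g \<otimes>\<^bsub>K\<^esub> b (inv\<^bsub>G\<^esub> g \<otimes>\<^bsub>G\<^esub> l)) l"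
      using lG by (simp add: group_algebra_mult)
    also have "\<dots> = (\<Oplus>\<^bsub>N\<^esub>g\<in>carrier G. W (a g \<otimes>\<^bsub>K\<^esub> b (inv\<^bsub>G\<^esub> g \<otimes>\<^bsub>G\<^esub> l)) l)"
      using W_closed W_add l ab finite
      by (intro finsum_additive_on[OF K.is_abelian_group NF.S.M.abelian_group_axioms
            K.add.subgroup_self, of "\<lambda>c. W c l"]) auto
    \<comment> \<open>The convolution in KG runs over the whole group; a vanishes outside
      G_i.\<close>
    also have "\<dots> = (\<Oplus>\<^bsub>N\<^esub>g\<in>GA.Gm i. W (a g \<otimes>\<^bsub>K\<^esub> b (inv\<^bsub>G\<^esub> g \<otimes>\<^bsub>G\<^esub> l)) l)"
    proof (rule NF.S.M.finsum_subset_eq[symmetric, OF finite GA.Gm_subset])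
      fix g assume "g \<in> carrier G - GA.Gm i"
      then have "a g = \<zero>\<^bsub>K\<^esub>" "b (inv\<^bsub>G\<^esub> g \<otimes>\<^bsub>G\<^esub> l) \<in> carrier K"
        using a bK lG by (auto simp: GA.filtration_iff)
      then show "W (a g \<otimes>\<^bsub>K\<^esub> b (inv\<^bsub>G\<^esub> g \<otimes>\<^bsub>G\<^esub> l)) l = \<zero>\<^bsub>N\<^esub>" using W_zero[OF l] by simp
    qed (use W_closed ab l in auto)
    finally show ?thesis .
  qed
  have Gi: "g \<in> carrier G" "g \<in> GA.Gm \<mu>" if "g \<in> GA.Gm i" for g
    using that GA.Gm_subset sub by blast+
  have "iact \<mu> (a \<otimes>\<^bsub>GA.A\<^esub> b) u Z = (\<Oplus>\<^bsub>N\<^esub>l\<in>GA.Gm \<mu>. W ((a \<otimes>\<^bsub>GA.A\<^esub> b) l) l)"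
    unfolding W_def by (rule induced_act_closed_apply(2)[OF abA u\<mu> Z])
  also have "\<dots> = (\<Oplus>\<^bsub>N\<^esub>l\<in>GA.Gm \<mu>. \<Oplus>\<^bsub>N\<^esub>g\<in>GA.Gm i. W (a g \<otimes>\<^bsub>K\<^esub> b (inv\<^bsub>G\<^esub> g \<otimes>\<^bsub>G\<^esub> l)) l)"
    using Gi aK bK W_closed
    by (intro NF.S.M.finsum_cong_closed conv_term NF.S.M.finsum_closed Pi_I) auto
  also have "\<dots> = (\<Oplus>\<^bsub>N\<^esub>g\<in>GA.Gm i. \<Oplus>\<^bsub>N\<^esub>l\<in>GA.Gm \<mu>. W (a g \<otimes>\<^bsub>K\<^esub> b (inv\<^bsub>G\<^esub> g \<otimes>\<^bsub>G\<^esub> l)) l)"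
    using Gi aK bK by (intro NF.S.M.finsum_swap Gm_finite W_closed) auto
  also have "\<dots> = (\<Oplus>\<^bsub>N\<^esub>g\<in>GA.Gm i. act_term i a (iact j b u) Z g)"
  proof (rule NF.S.M.finsum_cong_closed)
    fix g assume g: "g \<in> GA.Gm i"
    \<comment> \<open>Substitution l = g h: since G_i lies in G_\<mu>, left translation by g
      permutes G_\<mu>.\<close>
    have "(\<Oplus>\<^bsub>N\<^esub>l\<in>GA.Gm \<mu>. W (a g \<otimes>\<^bsub>K\<^esub> b (inv\<^bsub>G\<^esub> g \<otimes>\<^bsub>G\<^esub> l)) l)
        = (\<Oplus>\<^bsub>N\<^esub>l\<in>(\<lambda>h. g \<otimes>\<^bsub>G\<^esub> h) ` GA.Gm \<mu>. W (a g \<otimes>\<^bsub>K\<^esub> b (inv\<^bsub>G\<^esub> g \<otimes>\<^bsub>G\<^esub> l)) l)"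
      using G.left_mult_image_subgroup[OF GA.Gm_subgroup Gi(2)[OF g]] by simp
    also have "\<dots> = (\<Oplus>\<^bsub>N\<^esub>h\<in>GA.Gm \<mu>. W (a g \<otimes>\<^bsub>K\<^esub> b (inv\<^bsub>G\<^esub> g \<otimes>\<^bsub>G\<^esub> (g \<otimes>\<^bsub>G\<^esub> h))) (g \<otimes>\<^bsub>G\<^esub> h))"
    proof (rule NF.S.M.finsum_reindex)
      show "inj_on (\<lambda>h. g \<otimes>\<^bsub>G\<^esub> h) (GA.Gm \<mu>)"
        using G.inj_on_cmult[OF Gi(1)[OF g]] GA.Gm_subset inj_on_subset by blast
    qed (use Gi[OF g] aK bK in \<open>auto intro!: W_closed\<close>)
    also have "\<dots> = (\<Oplus>\<^bsub>N\<^esub>h\<in>GA.Gm \<mu>. W (a g \<otimes>\<^bsub>K\<^esub> b h) (g \<otimes>\<^bsub>G\<^esub> h))"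
      using Gi[OF g] aK bK
      by (intro NF.S.M.finsum_cong_closed W_closed) (auto simp: G.m_assoc[symmetric])
    \<comment> \<open>Now the support of b cuts the range down from G_\<mu> to G_j.\<close>
    also have "\<dots> = (\<Oplus>\<^bsub>N\<^esub>h\<in>GA.Gm j. W (a g \<otimes>\<^bsub>K\<^esub> b h) (g \<otimes>\<^bsub>G\<^esub> h))"
    proof (rule NF.S.M.finsum_subset_eq[symmetric, OF Gm_finite sub(2)])
      fix h assume h: "h \<in> GA.Gm \<mu> - GA.Gm j"
      then have "b h = \<zero>\<^bsub>K\<^esub>" using b by (auto simp: GA.filtration_iff)
      then show "W (a g \<otimes>\<^bsub>K\<^esub> b h) (g \<otimes>\<^bsub>G\<^esub> h) = \<zero>\<^bsub>N\<^esub>"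
        using h Gi[OF g] aK W_zero by simp
    qed (use Gi[OF g] aK bK in \<open>auto intro!: W_closed\<close>)
    finally show "(\<Oplus>\<^bsub>N\<^esub>l\<in>GA.Gm \<mu>. W (a g \<otimes>\<^bsub>K\<^esub> b (inv\<^bsub>G\<^esub> g \<otimes>\<^bsub>G\<^esub> l)) l) = act_term i a (iact j b u) Z g"
      by (simp add: term_eq[OF g])
    show "act_term i a (iact j b u) Z g \<in> carrier N" by (rule act_term_closed[OF aA bu Z g])
  qed
  also have "\<dots> = iact i a (iact j b u) Z"
    by (rule induced_act_closed_apply(2)[OF aA bu Z, symmetric])
  finally show "iact i a (iact j b u) Z = iact \<mu> (a \<otimes>\<^bsub>GA.A\<^esub> b) u Z" ..
qed

lemma induced_act_add_left:
  assumes a: "a \<in> GA.F i" and b: "b \<in> GA.F i" and u: "u \<in> Q \<rightarrow>\<^sub>E star N i"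
  shows "iact i (a \<oplus>\<^bsub>GA.A\<^esub> b) u = iact i a u \<oplus>\<^bsub>M\<^esub> iact i b u"
proof (rule carrier_P_eqI)
  note aA = GA.filtration_carrier[OF a] and bA = GA.filtration_carrier[OF b]
  have abA: "a \<oplus>\<^bsub>GA.A\<^esub> b \<in> carrier GA.A"
    using GA.abelian_group_algebra aA bA by (simp only: abelian_groupE(1))
  show "iact i (a \<oplus>\<^bsub>GA.A\<^esub> b) u \<in> carrier P" by (rule induced_act_closed_apply(1)[OF abA u])
  show "iact i a u \<oplus>\<^bsub>M\<^esub> iact i b u \<in> carrier P"
    using induced_act_closed[OF a u] induced_act_closed[OF b u] by auto
  fix Y assume Y: "Y \<in> Q"
  have "iact i (a \<oplus>\<^bsub>GA.A\<^esub> b) u Y = (\<Oplus>\<^bsub>N\<^esub>g\<in>GA.Gm i. act_term i (a \<oplus>\<^bsub>GA.A\<^esub> b) u Y g)"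
    by (rule induced_act_closed_apply(2)[OF abA u Y])
  also have "\<dots> = (\<Oplus>\<^bsub>N\<^esub>g\<in>GA.Gm i. act_term i a u Y g \<oplus>\<^bsub>N\<^esub> act_term i b u Y g)"
  proof (rule NF.S.M.finsum_cong_closed)
    fix g assume g: "g \<in> GA.Gm i"
    then have gG: "g \<in> carrier G" using GA.Gm_subset by blast
    have "act_term i (a \<oplus>\<^bsub>GA.A\<^esub> b) u Y g = scaled_act i (a g \<oplus>\<^bsub>K\<^esub> b g) (\<kappa> g (inv\<^bsub>G\<^esub> g \<rhd> Y)) (u (inv\<^bsub>G\<^esub> g \<rhd> Y))"
      using gG by simp
    also have "\<dots> = act_term i a u Y g \<oplus>\<^bsub>N\<^esub> act_term i b u Y g"
      using filtration_coeff[OF a gG] filtration_coeff[OF b gG] translate_inv_closed[OF g Y] g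
      by (intro scaled_act_add_coeff \<kappa>_in_H PiE_mem[OF u])
    finally show "act_term i (a \<oplus>\<^bsub>GA.A\<^esub> b) u Y g = act_term i a u Y g \<oplus>\<^bsub>N\<^esub> act_term i b u Y g" .
    show "act_term i a u Y g \<oplus>\<^bsub>N\<^esub> act_term i b u Y g \<in> carrier N"
      using act_term_closed[OF aA u Y g] act_term_closed[OF bA u Y g] by simp
  qed
  also have "\<dots> = (iact i a u \<oplus>\<^bsub>M\<^esub> iact i b u) Y"
    using Y act_term_closed[OF aA u Y] act_term_closed[OF bA u Y]
    by (simp add: NF.S.M.finsum_addf induced_act_closed_apply(2)[OF aA u Y] induced_act_closed_apply(2)[OF bA u Y])
  finally show "iact i (a \<oplus>\<^bsub>GA.A\<^esub> b) u Y = (iact i a u \<oplus>\<^bsub>M\<^esub> iact i b u) Y" .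
qed

lemma induced_act_add_right:
  assumes a: "a \<in> GA.F i" and u: "u \<in> Q \<rightarrow>\<^sub>E star N i" and v: "v \<in> Q \<rightarrow>\<^sub>E star N i"
  shows "iact i a (u \<oplus>\<^bsub>M\<^esub> v) = iact i a u \<oplus>\<^bsub>M\<^esub> iact i a v"
proof (rule carrier_P_eqI)
  note aA = GA.filtration_carrier[OF a]
  have uv: "u \<oplus>\<^bsub>M\<^esub> v \<in> Q \<rightarrow>\<^sub>E star N i"
    using PiE_mem[OF u] PiE_mem[OF v] subgroup.m_closed[OF star_subgroup] by simp
  show "iact i a (u \<oplus>\<^bsub>M\<^esub> v) \<in> carrier P" by (rule induced_act_closed_apply(1)[OF aA uv])
  show "iact i a u \<oplus>\<^bsub>M\<^esub> iact i a v \<in> carrier P"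
    using induced_act_closed[OF a u] induced_act_closed[OF a v] by auto
  fix Y assume Y: "Y \<in> Q"
  have "iact i a (u \<oplus>\<^bsub>M\<^esub> v) Y = (\<Oplus>\<^bsub>N\<^esub>g\<in>GA.Gm i. act_term i a (u \<oplus>\<^bsub>M\<^esub> v) Y g)"
    by (rule induced_act_closed_apply(2)[OF aA uv Y])
  also have "\<dots> = (\<Oplus>\<^bsub>N\<^esub>g\<in>GA.Gm i. act_term i a u Y g \<oplus>\<^bsub>N\<^esub> act_term i a v Y g)"
  proof (rule NF.S.M.finsum_cong_closed)
    fix g assume g: "g \<in> GA.Gm i"
    then have gG: "g \<in> carrier G" using GA.Gm_subset by blast
    note X = translate_inv_closed[OF g Y]
    have "act_term i a (u \<oplus>\<^bsub>M\<^esub> v) Y g = scaled_act i (a g) (\<kappa> g (inv\<^bsub>G\<^esub> g \<rhd> Y)) (u (inv\<^bsub>G\<^esub> g \<rhd> Y) \<oplus>\<^bsub>N\<^esub> v (inv\<^bsub>G\<^esub> g \<rhd> Y))"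
      using X by simp
    also have "\<dots> = act_term i a u Y g \<oplus>\<^bsub>N\<^esub> act_term i a v Y g"
      using filtration_coeff[OF a gG] g X PiE_mem[OF u X] PiE_mem[OF v X]
      by (intro scaled_act_add_arg \<kappa>_in_H)
    finally show "act_term i a (u \<oplus>\<^bsub>M\<^esub> v) Y g = act_term i a u Y g \<oplus>\<^bsub>N\<^esub> act_term i a v Y g" .
    show "act_term i a u Y g \<oplus>\<^bsub>N\<^esub> act_term i a v Y g \<in> carrier N"
      using act_term_closed[OF aA u Y g] act_term_closed[OF aA v Y g] by simp
  qed
  also have "\<dots> = (iact i a u \<oplus>\<^bsub>M\<^esub> iact i a v) Y"
    using Y act_term_closed[OF aA u Y] act_term_closed[OF aA v Y]
    by (simp add: NF.S.M.finsum_addf induced_act_closed_apply(2)[OF aA u Y] induced_act_closed_apply(2)[OF aA v Y])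
  finally show "iact i a (u \<oplus>\<^bsub>M\<^esub> v) Y = (iact i a u \<oplus>\<^bsub>M\<^esub> iact i a v) Y" .
qed

text \<open>The identity of G fixes every coset and has factor 1. Both the unit law in (f1) and the
  agreement of phi_0 with the action of F_0 are instances.\<close>

lemma induced_act_scalar:
  assumes "c \<in> carrier K" "u \<in> Q \<rightarrow>\<^sub>E star N i"
  shows "iact i (GA.monom c \<one>\<^bsub>G\<^esub>) u = (\<lambda>X\<in>Q. scal c (u X))"
proof (rule carrier_P_eqI)
  show "iact i (GA.monom c \<one>\<^bsub>G\<^esub>) u \<in> carrier P"
    by (rule induced_act_closed_apply(1)[OF GA.monom_closed assms(2)]) fact
  show "(\<lambda>X\<in>Q. scal c (u X)) \<in> carrier P"
    using assms(1) star_carrier[OF PiE_mem[OF assms(2)]] scal_closed by simp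
  fix Y assume "Y \<in> Q"
  then show "iact i (GA.monom c \<one>\<^bsub>G\<^esub>) u Y = (\<lambda>X\<in>Q. scal c (u X)) Y"
    using induced_act_monom[OF assms(1) one_in_Gm(1) assms(2)] assms
    by (simp add: translate_one \<kappa>_one scaled_act_one[OF assms(1) PiE_mem[OF assms(2)]])
qed

theorem induced_fragment: "fragment GA.A GA.F M"
proof (intro fragment.intro fragment_axioms.intro GA.positive_filtration induced_left_module)
  fix i j \<mu> a b u v
  show "level M 0 = carrier M" by (simp add: NF.level_0)
  show "subgroup (level M i) (add_monoid M)" "level M (Suc i) \<subseteq> level M i" "level M i \<subseteq> star M i"
    using PiE_subgroup[OF NF.S.M.abelian_group_axioms _ _ _ NF.level_subgroup, of M Q i]
      NF.level_antimono[of i] NF.f1_level[of i] by (auto intro: PiE_mono)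
  show "submodule (star M i) (GA.A\<lparr>carrier := GA.F 0\<rparr>) M"
  proof (intro submodule.intro submodule_axioms.intro)
    show "subgroup (star M i) (add_monoid M)"
      using PiE_subgroup[OF NF.S.M.abelian_group_axioms _ _ _ star_subgroup, of M Q i] by simp
    show "a \<odot>\<^bsub>M\<^esub> u \<in> star M i" if "a \<in> carrier (GA.A\<lparr>carrier := GA.F 0\<rparr>)" "u \<in> star M i" for a u
      using that filtration_coeff[OF _ G.one_closed, of a 0] scal_star by auto
  qed
  show "act M i a u \<in> carrier M" if "a \<in> GA.F i" "u \<in> star M i"
    using that induced_act_closed by simp
  show "act M i (a \<oplus>\<^bsub>GA.A\<^esub> b) u = act M i a u \<oplus>\<^bsub>M\<^esub> act M i b u"
    if "a \<in> GA.F i" "b \<in> GA.F i" "u \<in> star M i"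
    using induced_act_add_left that by (simp only: induced_fragment_simps)
  show "act M i a (u \<oplus>\<^bsub>M\<^esub> v) = act M i a u \<oplus>\<^bsub>M\<^esub> act M i a v"
    if "a \<in> GA.F i" "u \<in> star M i" "v \<in> star M i"
    using induced_act_add_right that by (simp only: induced_fragment_simps)
  show "act M i \<one>\<^bsub>GA.A\<^esub> u = u" if "u \<in> star M i"
  proof -
    have "act M i \<one>\<^bsub>GA.A\<^esub> u = (\<lambda>X\<in>Q. scal \<one>\<^bsub>K\<^esub> (u X))"
      using that induced_act_scalar[OF K.one_closed, of u i] by (simp only: GA.monom_one induced_fragment_simps)
    also have "\<dots> = u"
      using that star_carrier by (intro ext) (auto simp: PiE_arb[of u] intro!: scal_one)
    finally show ?thesis .
  qed
  show "act M 0 a u = a \<odot>\<^bsub>M\<^esub> u" if "a \<in> GA.F 0" "u \<in> carrier M"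
    using induced_act_scalar[OF filtration_coeff[OF that(1) G.one_closed], of u 0] that(2)
      filtration_monom_0[OF that(1)] star_0 by simp
  show "act M j a u \<in> level M (i - j)" "act M i a u = act M j a u"
    if "j \<le> i" "a \<in> GA.F j" "u \<in> level M i"
    using induced_act_level induced_act_coincide that by simp_all
  assume F: "\<And>a b. \<lbrakk>a \<in> GA.F i; b \<in> GA.F j\<rbrakk> \<Longrightarrow> a \<otimes>\<^bsub>GA.A\<^esub> b \<in> GA.F \<mu>"
    and le: "j \<le> \<mu>" and b: "b \<in> GA.F j" and u: "u \<in> level M \<mu>"
  note sub = filtration_product_chain[OF F]
  show "act M j b u \<in> star M i \<inter> level M (\<mu> - j)"
    using induced_act_star[OF le sub b] induced_act_level[OF le b] u by simp
  show "act M i a (act M j b u) = act M \<mu> (a \<otimes>\<^bsub>GA.A\<^esub> b) u" if "a \<in> GA.F i"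
    using induced_act_assoc[OF le sub that b] u by simp
qed

end

section \<open>Glider representations\<close>

definition module_fragment :: "('r, 'm) module \<Rightarrow> ('r, 'm) fragment" where
  "module_fragment \<Omega> =
    module.extend \<Omega> (fragment.fields (\<lambda>_. carrier \<Omega>) (\<lambda>_. carrier \<Omega>) (\<lambda>_. smult \<Omega>))"

lemma module_fragment_simps [simp]:
  "carrier (module_fragment \<Omega>) = carrier \<Omega>"
  "zero (module_fragment \<Omega>) = zero \<Omega>"
  "add (module_fragment \<Omega>) = add \<Omega>"
  "smult (module_fragment \<Omega>) = smult \<Omega>"
  "level (module_fragment \<Omega>) = (\<lambda>_. carrier \<Omega>)"
  "star (module_fragment \<Omega>) = (\<lambda>_. carrier \<Omega>)"
  "act (module_fragment \<Omega>) = (\<lambda>_. smult \<Omega>)"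
  by (simp_all add: module_fragment_def module.defs fragment.defs)

lemma abelian_group_cong:
  assumes "abelian_group A" "carrier B = carrier A" "zero B = zero A" "add B = add A"
  shows "abelian_group B"
proof -
  interpret A: abelian_group A by fact
  show ?thesis
    using A.a_assoc A.a_comm A.l_neg A.a_inv_closed by (intro abelian_groupI) (auto simp: assms(2-4))
qed

lemma fragment_module_fragment:
  assumes "positive_filtration R F" "left_module R \<Omega>"
  shows "fragment R F (module_fragment \<Omega>)"
proof -
  interpret R: positive_filtration R F by fact
  interpret \<Omega>: left_module R \<Omega> by fact
  let ?M = "module_fragment \<Omega>"
  have FR: "a \<in> carrier R" if "a \<in> F i" for a i
    using that subgroup.subset[OF R.filt_subgroup[of i]] by auto
  have M: "abelian_group ?M" by (rule abelian_group_cong[OF \<Omega>.M.abelian_group_axioms]) simp_all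
  interpret M: abelian_group ?M by (rule M)
  have sub: "subgroup (carrier \<Omega>) (add_monoid ?M)" using M.add.subgroup_self by simp
  show ?thesis
  proof (intro fragment.intro fragment_axioms.intro left_module.intro left_module_axioms.intro
      submodule.intro submodule_axioms.intro R.filtration_0_ring M R.positive_filtration_axioms)
  qed (use sub in \<open>simp_all add: FR \<Omega>.lm_closed \<Omega>.lm_l_distr \<Omega>.lm_r_distr \<Omega>.lm_assoc \<Omega>.lm_one\<close>)
qed

section \<open>The ambient KG-module and the stars of a glider\<close>

context induction_datum
begin

text \<open>On the constant chain \<open>\<Omega>\<close>, (f3) with \<open>i = j = \<mu> = d\<close> is associativity for all of \<open>KG\<close>.\<close>

definition ambient where
  "ambient \<Omega> = (induced_module K G H (module_fragment \<Omega>))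
    \<lparr>smult := induced_act K G H Gs d T (module_fragment \<Omega>) d\<rparr>"

lemma ambient_simps [simp]:
  "carrier (ambient \<Omega>) = carrier (G Mod H) \<rightarrow>\<^sub>E carrier \<Omega>"
  "zero (ambient \<Omega>) = (\<lambda>X\<in>carrier (G Mod H). \<zero>\<^bsub>\<Omega>\<^esub>)"
  "add (ambient \<Omega>) = (\<lambda>u v. \<lambda>X\<in>carrier (G Mod H). u X \<oplus>\<^bsub>\<Omega>\<^esub> v X)"
  "smult (ambient \<Omega>) = induced_act K G H Gs d T (module_fragment \<Omega>) d"
  by (simp_all add: ambient_def)

lemma module_fragment_induction:
  assumes "left_module HA.A \<Omega>"
  shows "fragment_induction K G H Gs T d (module_fragment \<Omega>)"
  by (intro fragment_induction.intro induction_datum_axioms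
      fragment_module_fragment HA.positive_filtration assms)

lemma filtration_top: "GA.F d = carrier GA.A"
  by (simp add: ga_filtration_def GA.chain_top)

lemma left_module_ambient:
  assumes "left_module HA.A \<Omega>"
  shows "left_module GA.A (ambient \<Omega>)"
proof -
  interpret O: fragment_induction K G H Gs T d "module_fragment \<Omega>"
    by (rule module_fragment_induction[OF assms])
  interpret IO: fragment GA.A GA.F O.M by (rule O.induced_fragment)
  have st: "star O.M d = carrier (ambient \<Omega>)" "level O.M d = carrier (ambient \<Omega>)" by simp_all
  have ab: "abelian_group (ambient \<Omega>)"
    by (rule abelian_group_cong[OF O.abelian_P]) simp_all
  show ?thesis
  proof (intro left_module.intro left_module_axioms.intro GA.ring_group_algebra ab)
    fix a b u v
    assume a: "a \<in> carrier GA.A" and u: "u \<in> carrier (ambient \<Omega>)"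
    \<comment> \<open>G_d = G puts every element of KG into F_d, so the fragment axioms at index d
      hold for all scalars.\<close>
    note F = a[folded filtration_top]
    show "a \<odot>\<^bsub>ambient \<Omega>\<^esub> u \<in> carrier (ambient \<Omega>)"
      using IO.f1_closed[OF F, of u] u by simp
    show "a \<odot>\<^bsub>ambient \<Omega>\<^esub> (u \<oplus>\<^bsub>ambient \<Omega>\<^esub> v) = a \<odot>\<^bsub>ambient \<Omega>\<^esub> u \<oplus>\<^bsub>ambient \<Omega>\<^esub> a \<odot>\<^bsub>ambient \<Omega>\<^esub> v"
      if "v \<in> carrier (ambient \<Omega>)"
      using IO.f1_add_right[OF F, of u v] u that by simp
    assume b: "b \<in> carrier GA.A"
    note Fb = b[folded filtration_top]
    show "(a \<oplus>\<^bsub>GA.A\<^esub> b) \<odot>\<^bsub>ambient \<Omega>\<^esub> u = a \<odot>\<^bsub>ambient \<Omega>\<^esub> u \<oplus>\<^bsub>ambient \<Omega>\<^esub> b \<odot>\<^bsub>ambient \<Omega>\<^esub> u"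
      using IO.f1_add_left[OF F Fb, of u] u by (simp only: st ambient_simps induced_fragment_simps module_fragment_simps)
    have "act O.M d a (act O.M d b u) = act O.M d (a \<otimes>\<^bsub>GA.A\<^esub> b) u"
    proof (rule IO.f3_assoc[OF _ order_refl F Fb])
      show "x \<otimes>\<^bsub>GA.A\<^esub> y \<in> GA.F d" if "x \<in> GA.F d" "y \<in> GA.F d" for x y
        using that unfolding filtration_top by (rule GA.mult_closed)
    qed (use u in simp)
    then show "(a \<otimes>\<^bsub>GA.A\<^esub> b) \<odot>\<^bsub>ambient \<Omega>\<^esub> u = a \<odot>\<^bsub>ambient \<Omega>\<^esub> (b \<odot>\<^bsub>ambient \<Omega>\<^esub> u)"
      by simp
  next
    fix u assume "u \<in> carrier (ambient \<Omega>)"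
    then show "\<one>\<^bsub>GA.A\<^esub> \<odot>\<^bsub>ambient \<Omega>\<^esub> u = u"
      using IO.f1_one[of u d] by (simp only: st ambient_simps induced_fragment_simps module_fragment_simps)
  qed
qed

text \<open>Once the two actions agree on the stars, (f1) shows that F_iKG sends the star into N^G.
  The converse is proved one coordinate at a time: if F_iKG keeps u inside N^G, then F_iKH keeps
  each \<open>u X\<close> inside \<open>N\<close>, and the description of the stars of
  \<open>N\<close> applies.\<close>

lemma glider_induced:
  fixes N :: "('a \<Rightarrow> 'k, 'm) fragment"
  assumes "glider_representation HA.A HA.F N"
  shows "glider_representation GA.A GA.F (induced_fragment K G H Gs d T N)"
proof -
  obtain \<Omega> :: "('a \<Rightarrow> 'k, 'm) module" where N: "fragment HA.A HA.F N" and \<Omega>: "left_module HA.A \<Omega>"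
    and car: "carrier N \<subseteq> carrier \<Omega>"
    and add: "\<And>x y. \<lbrakk>x \<in> carrier N; y \<in> carrier N\<rbrakk> \<Longrightarrow> x \<oplus>\<^bsub>N\<^esub> y = x \<oplus>\<^bsub>\<Omega>\<^esub> y"
    and act: "\<And>i a x. \<lbrakk>a \<in> HA.F i; x \<in> star N i\<rbrakk> \<Longrightarrow> act N i a x = a \<odot>\<^bsub>\<Omega>\<^esub> x"
    and star: "\<And>i. star N i = {x \<in> carrier N. \<forall>a\<in>HA.F i. a \<odot>\<^bsub>\<Omega>\<^esub> x \<in> carrier N}"
    using assms unfolding glider_representation_def by blast
  interpret N: fragment_induction K G H Gs T d N
    by (intro fragment_induction.intro induction_datum_axioms N)
  interpret O: fragment_induction K G H Gs T d "module_fragment \<Omega>"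
    by (rule module_fragment_induction[OF \<Omega>])
  interpret \<Omega>: left_module HA.A \<Omega> by (rule \<Omega>)
  \<comment> \<open>Only the additions of \<open>N\<close> and \<open>\<Omega>\<close> are assumed
    to agree. The inclusion is then an additive map, hence respects zero and all finite
    sums.\<close>
  have finsum_eq: "finsum N f I = finsum \<Omega> f I" if "finite I" "\<And>i. i \<in> I \<Longrightarrow> f i \<in> carrier N"
    for f :: "'a \<Rightarrow> 'm" and I
    using finsum_additive_on[OF N.NF.S.M.abelian_group_axioms \<Omega>.M.abelian_group_axioms
        N.NF.S.M.add.subgroup_self, of "\<lambda>x. x" I f] car add that by auto
  have finsum_\<Omega>_eq: "finsum (module_fragment \<Omega>) f I = finsum \<Omega> f I"
    if "finite I" "\<And>i. i \<in> I \<Longrightarrow> f i \<in> carrier \<Omega>" for f :: "'a \<Rightarrow> 'm" and I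
    using that by (intro finsum_additive_on[OF O.NF.S.M.abelian_group_axioms
        \<Omega>.M.abelian_group_axioms O.NF.S.M.add.subgroup_self, of "\<lambda>x. x"]) simp_all
  \<comment> \<open>The scalar multiplication of \<open>N\<close> is compared with that of
    \<open>\<Omega>\<close> through phi_0, for which the agreement is known on
    \<open>star N 0\<close>, that is, on all of \<open>N\<close>.\<close>
  have scaled_act_eq: "N.scaled_act i c k x = O.scaled_act i c k x"
    if "c \<in> carrier K" "k \<in> HA.Gm i" "x \<in> star N i" for i c k x
  proof -
    have "act N i (HA.monom \<one>\<^bsub>K\<^esub> k) x \<in> star N 0"
      unfolding N.star_0 using that by (intro N.NF.f1_closed N.unit_in_filtration)
    then show ?thesis
      using that N.scal_act_0[of c "act N i (HA.monom \<one>\<^bsub>K\<^esub> k) x"]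
        act[OF N.scalar_in_filtration[of c 0]] act[OF N.unit_in_filtration] N.star_0
      unfolding N.scaled_act_def O.scaled_act_def by simp
  qed
  have star_\<Omega>: "u \<in> N.Q \<rightarrow>\<^sub>E star (module_fragment \<Omega>) i" if "u \<in> carrier N.M" for u i
    using that car by auto
  have act_eq: "N.iact i a u = a \<odot>\<^bsub>ambient \<Omega>\<^esub> u" if a: "a \<in> GA.F i" and u: "u \<in> N.Q \<rightarrow>\<^sub>E star N i" for i a u
  proof -
    note aA = GA.filtration_carrier[OF a]
    have uM: "u \<in> carrier N.M" using u N.star_carrier by auto
    have "N.iact i a u Y = O.iact i a u Y" if Y: "Y \<in> N.Q" for Y
    proof -
      have "N.iact i a u Y = (\<Oplus>\<^bsub>N\<^esub>g\<in>GA.Gm i. N.act_term i a u Y g)"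
        by (rule N.induced_act_closed_apply(2)[OF aA u Y])
      also have "\<dots> = (\<Oplus>\<^bsub>\<Omega>\<^esub>g\<in>GA.Gm i. N.act_term i a u Y g)"
        using N.act_term_closed[OF aA u Y] by (rule finsum_eq[OF N.Gm_finite])
      also have "\<dots> = (\<Oplus>\<^bsub>\<Omega>\<^esub>g\<in>GA.Gm i. O.act_term i a u Y g)"
      proof (rule \<Omega>.M.finsum_cong_closed)
        fix g assume g: "g \<in> GA.Gm i"
        then have "a g \<in> carrier K" using N.filtration_coeff[OF a] GA.Gm_subset by blast
        then show "N.act_term i a u Y g = O.act_term i a u Y g"
          using N.translate_inv_closed[OF g Y] g by (intro scaled_act_eq N.\<kappa>_in_H PiE_mem[OF u])
        show "O.act_term i a u Y g \<in> carrier \<Omega>"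
          using O.act_term_closed[OF aA star_\<Omega>[OF uM] Y g] by simp
      qed
      also have "\<dots> = O.iact i a u Y"
        using O.act_term_closed[OF aA star_\<Omega>[OF uM] Y] O.induced_act_closed_apply(2)[OF aA star_\<Omega>[OF uM] Y]
        by (simp add: finsum_\<Omega>_eq[OF N.Gm_finite])
      finally show ?thesis .
    qed
    then have "N.iact i a u = O.iact i a u"
      using N.induced_act_closed[OF a u] O.induced_act_closed[OF a star_\<Omega>[OF uM]]
      by (intro extensionalityI[of _ N.Q]) (simp_all add: PiE_def)
    \<comment> \<open>In the constant chain every level is \<open>\<Omega>\<close>, so (f2) compares
      phi_i with phi_d whichever index is larger; for i > d it uses that a lies in F_d = KG.\<close>
    also have "\<dots> = O.iact d a u"
    proof (cases "i \<le> d")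
      case True
      then show ?thesis using O.induced_act_coincide[OF True a] star_\<Omega>[OF uM] by simp
    next
      case False
      then show ?thesis
        using O.induced_act_coincide[of d i a u] aA star_\<Omega>[OF uM] filtration_top by simp
    qed
    finally show ?thesis by simp
  qed
  have star_mem: "u X \<in> star N i"
    if u: "u \<in> carrier N.M" and X: "X \<in> N.Q"
      and stable: "\<And>a. a \<in> GA.F i \<Longrightarrow> a \<odot>\<^bsub>ambient \<Omega>\<^esub> u \<in> carrier N.M" for u X i
  proof -
    have uX: "u X \<in> carrier N" "u X \<in> carrier \<Omega>" using u X car by auto
    have "b \<odot>\<^bsub>\<Omega>\<^esub> u X \<in> carrier N" if b: "b \<in> HA.F i" for b
    proof -
      note bA = HA.filtration_carrier[OF b]
      have bK: "b h \<in> carrier K" if "h \<in> H" for h using HA.coeff_closed[OF bA] that by simp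
      have summand: "HA.monom (b h) h \<odot>\<^bsub>\<Omega>\<^esub> u X \<in> carrier N" if h: "h \<in> H" for h
      proof (cases "h \<in> HA.Gm i")
        case True
        \<comment> \<open>Since g fixes X, the coordinate X of b(h) g u is b(h) h (u X), whatever
          the other coordinates of u are. No projection onto a single coset is required.\<close>
        then obtain g where g: "g \<in> GA.Gm i" "g \<rhd> X = X" "\<kappa> g X = h" using \<kappa>_surj X by blast
        have gG: "g \<in> carrier G" using g(1) GA.Gm_subset by blast
        have gX: "inv\<^bsub>G\<^esub> g \<rhd> X = X" using translate_inv(2)[OF gG X] g(2) by simp
        have gd: "g \<in> GA.Gm d" using gG GA.chain_top by simp
        have "h \<in> HA.Gm d" using h H.subset GA.chain_top by auto
        then have "HA.monom (b h) h \<odot>\<^bsub>\<Omega>\<^esub> u X = O.scaled_act d (b h) h (u X)"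
          using O.scaled_act_act[of "b h" h d "u X"] bK[OF h] uX by simp
        also have "\<dots> = (GA.monom (b h) g \<odot>\<^bsub>ambient \<Omega>\<^esub> u) X"
          using O.induced_act_monom[OF bK[OF h] gd star_\<Omega>[OF u] X] gX g(3) by simp
        also have "\<dots> \<in> carrier N"
          using stable[OF GA.monom_in_filtration[OF bK[OF h] g(1)]] X by auto
        finally show ?thesis .
      next
        case False
        then have "HA.monom (b h) h = \<zero>\<^bsub>HA.A\<^esub>"
          using b h HA.monom_zero by (simp add: HA.filtration_iff)
        \<comment> \<open>For h outside H_i the coefficient b(h) is zero. That zero times
          \<open>u X\<close> lies in \<open>N\<close> is seen from phi_0, whose values lie in
          \<open>N\<close> by (f1).\<close>
        moreover have "\<zero>\<^bsub>HA.A\<^esub> \<odot>\<^bsub>\<Omega>\<^esub> u X = act N 0 \<zero>\<^bsub>HA.A\<^esub> (u X)"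
          using act[OF N.scalar_in_filtration[OF K.zero_closed, of 0], of "u X"] uX N.star_0 HA.monom_zero
          by simp
        ultimately show ?thesis
          using N.NF.f1_closed[OF N.scalar_in_filtration[OF K.zero_closed, of 0], of "u X"] uX N.star_0 HA.monom_zero
          by simp
      qed
      have Hfin: "finite H" using H.subset finite finite_subset by blast
      have "b \<odot>\<^bsub>\<Omega>\<^esub> u X = (\<Oplus>\<^bsub>HA.A\<^esub>h\<in>H. HA.monom (b h) h) \<odot>\<^bsub>\<Omega>\<^esub> u X"
        using HA.finsum_monom[OF bA] by simp
      also have "\<dots> = (\<Oplus>\<^bsub>\<Omega>\<^esub>h\<in>H. HA.monom (b h) h \<odot>\<^bsub>\<Omega>\<^esub> u X)"
        using HA.monom_closed[OF bK]
        by (intro finsum_additive_on[OF HA.abelian_group_algebra \<Omega>.M.abelian_group_axioms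
              group.subgroup_self[OF abelian_group.a_group[OF HA.abelian_group_algebra]], of "\<lambda>c. c \<odot>\<^bsub>\<Omega>\<^esub> u X"] \<Omega>.lm_closed \<Omega>.lm_l_distr uX Hfin) simp_all
      also have "\<dots> = (\<Oplus>\<^bsub>N\<^esub>h\<in>H. HA.monom (b h) h \<odot>\<^bsub>\<Omega>\<^esub> u X)"
        using finsum_eq[OF Hfin summand] by simp
      also have "\<dots> \<in> carrier N" using summand by (intro N.NF.S.M.finsum_closed Pi_I)
      finally show ?thesis .
    qed
    then show ?thesis using uX star by simp
  qed
  show ?thesis
    unfolding glider_representation_def
  proof (intro conjI exI[of _ "ambient \<Omega>"] allI ballI N.induced_fragment left_module_ambient \<Omega>)
    show "carrier N.M \<subseteq> carrier (ambient \<Omega>)" using car by (auto simp: PiE_iff)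
    show "u \<oplus>\<^bsub>N.M\<^esub> v = u \<oplus>\<^bsub>ambient \<Omega>\<^esub> v" if "u \<in> carrier N.M" "v \<in> carrier N.M" for u v
      using that by (auto intro!: restrict_ext add)
    show "act N.M i a u = a \<odot>\<^bsub>ambient \<Omega>\<^esub> u" if "a \<in> GA.F i" "u \<in> star N.M i" for i a u
      using act_eq that by simp
    show "star N.M i = {u \<in> carrier N.M. \<forall>a\<in>GA.F i. a \<odot>\<^bsub>ambient \<Omega>\<^esub> u \<in> carrier N.M}" (is "_ = ?S") for i
    proof (intro equalityI subsetI)
      fix u assume "u \<in> star N.M i"
      then have u: "u \<in> N.Q \<rightarrow>\<^sub>E star N i" by simp
      have "a \<odot>\<^bsub>ambient \<Omega>\<^esub> u \<in> carrier N.M" if "a \<in> GA.F i" for a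
        using N.induced_act_closed[OF that u] act_eq[OF that u] by simp
      moreover have "u \<in> carrier N.M" using u N.star_carrier by auto
      ultimately show "u \<in> ?S" by blast
    next
      fix u assume u: "u \<in> ?S"
      then have "u X \<in> star N i" if "X \<in> N.Q" for X using star_mem that by blast
      then show "u \<in> star N.M i" using u by (auto simp: PiE_iff)
    qed
  qed
qed

lemma natural_induced:
  fixes N :: "('a \<Rightarrow> 'k, 'm) fragment"
  assumes "natural_fragment HA.A HA.F N"
  shows "natural_fragment GA.A GA.F (induced_fragment K G H Gs d T N)"
  using assms glider_induced[of N] unfolding natural_fragment_def by auto

end

theorem proposition3p4:
  fixes K :: "('k, 'c) ring_scheme"
    and G :: "('a, 'b) monoid_scheme"
    and H :: "'a set"
    and Gs T :: "nat \<Rightarrow> 'a set"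
    and d :: nat
    and N :: "('a \<Rightarrow> 'k, 'm) fragment"
  assumes "field K"
    and "group G"
    and "finite (carrier G)"
    and "1 \<le> d"
    and "normal_chain G Gs d"
    and "H \<lhd> G"
    and "\<forall>i\<le>d. H \<inter> Gs i \<lhd> G"
    and "ascending_transversal G H Gs d T"
    and "filtered_cocycle G H Gs d T"
  shows "(fragment (group_algebra K (G\<lparr>carrier := H\<rparr>))
            (ga_filtration K (G\<lparr>carrier := H\<rparr>) (\<lambda>i. H \<inter> Gs i) d) N \<longrightarrow>
          fragment (group_algebra K G) (ga_filtration K G Gs d)
            (induced_fragment K G H Gs d T N)) \<and>
         (glider_representation (group_algebra K (G\<lparr>carrier := H\<rparr>))
            (ga_filtration K (G\<lparr>carrier := H\<rparr>) (\<lambda>i. H \<inter> Gs i) d) N \<longrightarrow>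
          glider_representation (group_algebra K G) (ga_filtration K G Gs d)
            (induced_fragment K G H Gs d T N)) \<and>
         (natural_fragment (group_algebra K (G\<lparr>carrier := H\<rparr>))
            (ga_filtration K (G\<lparr>carrier := H\<rparr>) (\<lambda>i. H \<inter> Gs i) d) N \<longrightarrow>
          natural_fragment (group_algebra K G) (ga_filtration K G Gs d)
            (induced_fragment K G H Gs d T N))"
proof -
  interpret induction_datum K G H Gs T d
    using assms by (rule induction_datum.intro)
  show ?thesis
    using fragment_induction.induced_fragment[OF fragment_induction.intro[OF induction_datum_axioms]]
      glider_induced natural_induced by blast
qed

end
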